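(* (1) Let $U\subseteq A\subseteq\mathbb{Z}_p^n$ be an open and compact subset of an algebraic set $A$ of dimension $\dim(A)=a$. Then $$\mathrm{vol}_a(U)=\lim_{m\to\infty}\frac{N_m(U)}{p^{ma}}.$$ (2) Let $U\subseteq A\subseteq\mathbb{P}^n$ be an open and compact subset of an algebraic set $A$ of dimension $\dim(A)=a$. Then $$\mathrm{vol}_a(U)=\lim_{m\to\infty}\frac{N_m(U)}{p^{ma}}.$$
   Context: Let $p$ be a prime, $|p|_p=p^{-1}$, $\|\cdot\|_p$ the max norm on $\mathbb{Q}_p^n$ (and on $\mathbb{Q}_p^{n+1}$), $\mu$ the Haar measure with $\mu(\mathbb{Z}_p^n)=1$ (resp. $\mu(\mathbb{Z}_p^{n+1})=1$). $\mathbb{P}^n$ denotes $\mathbb{P}^n(\mathbb{Q}_p)=\mathbb{P}^n(\mathbb{Z}_p)$; $S^n=\{a\in\mathbb{Q}_p^{n+1}:\|a\|_p=1\}$, $\varphi:S^n\to\mathbb{P}^n$ is the natural projection. $\mathbb{P}^n$ has the metric $d(x,y)=\|\hat x\wedge\hat y\|_p$ for any $\hat x\in\varphi^{-1}(x)$, $\hat y\in\varphi^{-1}(y)$ (maximal absolute value of $2\times2$ minors) and the measure $\mu(W)=\frac{1}{1-p^{-1}}\mu(\varphi^{-1}(W))$. In both the affine and projective case $B(x,r)$ is the closed ball $\{y:d(x,y)\le r\}$. An algebraic set in $\mathbb{Z}_p^n$ is the set of $\mathbb{Z}_p$-points of the zero locus of polynomials over $\mathbb{Q}_p$; in $\mathbb{P}^n$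 the zero locus of homogeneous polynomials over $\mathbb{Q}_p$. For $U$ an open compact subset (in the $p$-adic topology) of an algebraic set of dimension $a$ in $\mathbb{Z}_p^n$ or in $\mathbb{P}^n$, $\mathrm{vol}_a(U)=\lim_{m\to\infty}p^{m(n-a)}\mu\big(\bigcup_{x\in U}B(x,p^{-m})\big)$ (the limit is known to exist and be finite). $N_m(U)$ is the cardinality of the image of $U$ under the reduction map $\mathbb{Z}_p^n\to(\mathbb{Z}/p^m\mathbb{Z})^n$ in the affine case, and $\mathbb{P}^n(\mathbb{Z}_p)\to\mathbb{P}^n(\mathbb{Z}/p^m\mathbb{Z})$ in the projective case. *)

theory Defs
  imports "HOL-Analysis.Analysis" "HOL-Library.Poly_Mapping" "HOL-Number_Theory.Cong"
begin

section \<open>The field of \<open>p\<close>-adic numbers\<close>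

subsection \<open>The \<open>p\<close>-adic absolute value on the rationals\<close>

definition padic_abs :: "nat \<Rightarrow> rat \<Rightarrow> real" where
  "padic_abs p x =
     (if x = 0 then 0
      else case quotient_of x of (a, b) \<Rightarrow>
        real p powi (int (multiplicity (int p) b) - int (multiplicity (int p) a)))"

context
  fixes p :: nat
  assumes p: "prime p"
begin

lemma p_gt_1: "real p > 1"
  using p prime_gt_1_nat by auto

lemma padic_abs_0: "padic_abs p 0 = 0"
  by (simp add: padic_abs_def)

lemma padic_abs_Fract:
  assumes "a \<noteq> 0" "b \<noteq> 0"
  shows "padic_abs p (Fract a b) =
    real p powi (int (multiplicity (int p) b) - int (multiplicity (int p) a))"
proof -
  obtain a' b' where q: "quotient_of (Fract a b) = (a', b')" by fastforce
  have b': "b' > 0" using quotient_of_denom_pos[OF q] .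
  have eq: "Fract a b = Fract a' b'"
    using Fract_of_int_quotient quotient_of_div[OF q] by simp
  then have cross: "a * b' = a' * b" using assms b' by (simp add: eq_rat)
  have a': "a' \<noteq> 0" using cross assms b' by auto
  have pe: "prime_elem (int p)" using p by simp
  have "multiplicity (int p) a + multiplicity (int p) b' =
        multiplicity (int p) a' + multiplicity (int p) b"
    using cross prime_elem_multiplicity_mult_distrib[OF pe, of a b']
      prime_elem_multiplicity_mult_distrib[OF pe, of a' b] assms a' b' by simp
  then have "int (multiplicity (int p) b) - int (multiplicity (int p) a) =
        int (multiplicity (int p) b') - int (multiplicity (int p) a')" by linarith
  moreover have "Fract a b \<noteq> 0" using assms by (simp add: Zero_rat_def eq_rat)
  ultimately show ?thesis by (simp add: padic_abs_def q)
qed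

lemma padic_abs_eq_0_iff: "padic_abs p x = 0 \<longleftrightarrow> x = 0"
  using p_gt_1 by (auto simp: padic_abs_def split: prod.splits)

lemma padic_abs_nonneg: "padic_abs p x \<ge> 0"
  using p_gt_1 by (auto simp: padic_abs_def split: prod.splits)

lemma padic_abs_mult: "padic_abs p (x * y) = padic_abs p x * padic_abs p y"
proof (cases "x = 0 \<or> y = 0")
  case True then show ?thesis by (auto simp: padic_abs_0)
next
  case False
  obtain a b where x: "x = Fract a b" "b > 0" by (cases x) auto
  obtain c d where y: "y = Fract c d" "d > 0" by (cases y) auto
  have nz: "a \<noteq> 0" "c \<noteq> 0" using False x y by (auto simp: Zero_rat_def eq_rat)
  have pe: "prime_elem (int p)" using p by simp
  show ?thesis
    using nz x y p_gt_1
    by (simp add: padic_abs_Fract prime_elem_multiplicity_mult_distrib[OF pe]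
        power_int_add[symmetric] algebra_simps)
qed

lemma padic_abs_1: "padic_abs p 1 = 1"
  using padic_abs_Fract[of 1 1] by (simp add: One_rat_def)

lemma padic_abs_minus: "padic_abs p (- x) = padic_abs p x"
proof -
  have "padic_abs p (-1) * padic_abs p (-1) = 1"
    using padic_abs_mult[of "-1" "-1"] padic_abs_1 by simp
  then have "padic_abs p (-1) = 1"
    using padic_abs_nonneg[of "-1"] abs_square_eq_1[of "padic_abs p (-1)"]
    by (simp add: power2_eq_square)
  then show ?thesis using padic_abs_mult[of "-1" x] by simp
qed

lemma padic_abs_minus_commute: "padic_abs p (x - y) = padic_abs p (y - x)"
  using padic_abs_minus[of "x - y"] by simp

lemma padic_abs_inverse: "padic_abs p (inverse x) = inverse (padic_abs p x)"
proof (cases "x = 0")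
  case False
  then have "padic_abs p x * padic_abs p (inverse x) = 1"
    using padic_abs_mult[of x "inverse x"] padic_abs_1 by simp
  then show ?thesis by (metis inverse_unique)
qed (simp add: padic_abs_0)

lemma padic_abs_add: "padic_abs p (x + y) \<le> max (padic_abs p x) (padic_abs p y)"
proof (cases "x = 0 \<or> y = 0 \<or> x + y = 0")
  case True then show ?thesis
    using padic_abs_nonneg[of x] padic_abs_nonneg[of y] by (auto simp: padic_abs_0)
next
  case False
  obtain a b where x: "x = Fract a b" "b > 0" by (cases x) auto
  obtain c d where y: "y = Fract c d" "d > 0" by (cases y) auto
  define u v w where "u = a * d" and "v = c * b" and "w = b * d"
  have w: "w \<noteq> 0" using x y by (simp add: w_def)
  have xw: "x = Fract u w" and yw: "y = Fract v w"
    using x y by (simp_all add: u_def v_def w_def eq_rat)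
  have sw: "x + y = Fract (u + v) w"
    using w by (simp add: xw yw eq_rat algebra_simps)
  have nz: "u \<noteq> 0" "v \<noteq> 0" "u + v \<noteq> 0"
    using False xw yw sw w by (auto simp: Zero_rat_def eq_rat)
  let ?m = "multiplicity (int p)"
  have "int p ^ min (?m u) (?m v) dvd u" "int p ^ min (?m u) (?m v) dvd v"
    by (auto intro!: multiplicity_dvd')
  then have "int p ^ min (?m u) (?m v) dvd u + v" by simp
  then have "min (?m u) (?m v) \<le> ?m (u + v)"
    using nz p prime_gt_1_nat[OF p] by (intro multiplicity_geI) auto
  then have "?m u \<le> ?m (u + v) \<or> ?m v \<le> ?m (u + v)" by linarith
  moreover have mono: "real p powi (int (?m w) - int k) \<le> real p powi (int (?m w) - int l)"
    if "l \<le> k" for k l using p_gt_1 that by (intro power_int_increasing) auto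
  ultimately show ?thesis
    unfolding sw unfolding xw yw padic_abs_Fract[OF nz(1) w] padic_abs_Fract[OF nz(2) w]
      padic_abs_Fract[OF nz(3) w] by (auto simp: le_max_iff_disj)
qed

lemma padic_abs_triangle: "padic_abs p (x + y) \<le> padic_abs p x + padic_abs p y"
  using padic_abs_add[of x y] padic_abs_nonneg[of x] padic_abs_nonneg[of y] by linarith

lemma padic_abs_diff_triangle: "\<bar>padic_abs p x - padic_abs p y\<bar> \<le> padic_abs p (x - y)"
  using padic_abs_triangle[of "x - y" y] padic_abs_triangle[of "y - x" x]
    padic_abs_minus_commute[of x y] by auto

subsection \<open>Cauchy sequences and null sequences\<close>

definition padic_null :: "(nat \<Rightarrow> rat) \<Rightarrow> bool" where
  "padic_null X \<longleftrightarrow> (\<lambda>n. padic_abs p (X n)) \<longlonglongrightarrow> 0"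

definition padic_cauchy :: "(nat \<Rightarrow> rat) \<Rightarrow> bool" where
  "padic_cauchy X \<longleftrightarrow> (\<forall>e>0. \<exists>M. \<forall>m\<ge>M. \<forall>n\<ge>M. padic_abs p (X m - X n) < e)"

lemma padic_cauchy_const: "padic_cauchy (\<lambda>n. c)"
  by (simp add: padic_cauchy_def padic_abs_0)

lemma padic_null_0: "padic_null (\<lambda>n. 0)"
  by (simp add: padic_null_def padic_abs_0)

lemma padic_cauchy_abs_convergent:
  assumes "padic_cauchy X"
  shows "convergent (\<lambda>n. padic_abs p (X n))"
proof (rule Cauchy_convergent, rule metric_CauchyI)
  fix e :: real assume "e > 0"
  then obtain M where "\<forall>m\<ge>M. \<forall>n\<ge>M. padic_abs p (X m - X n) < e"
    using assms unfolding padic_cauchy_def by blast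
  then show "\<exists>M. \<forall>m\<ge>M. \<forall>n\<ge>M. dist (padic_abs p (X m)) (padic_abs p (X n)) < e"
    unfolding dist_real_def using le_less_trans[OF padic_abs_diff_triangle] by blast
qed

lemma padic_null_add: "padic_null X \<Longrightarrow> padic_null Y \<Longrightarrow> padic_null (\<lambda>n. X n + Y n)"
  unfolding padic_null_def
  by (rule tendsto_sandwich[of "\<lambda>_. 0" _ _ "\<lambda>n. padic_abs p (X n) + padic_abs p (Y n)"])
     (auto simp: padic_abs_nonneg padic_abs_triangle intro: tendsto_add_zero)

lemma padic_null_minus: "padic_null X \<Longrightarrow> padic_null (\<lambda>n. - X n)"
  by (simp add: padic_null_def padic_abs_minus)

lemma padic_null_mult: "padic_null X \<Longrightarrow> padic_cauchy Y \<Longrightarrow> padic_null (\<lambda>n. X n * Y n)"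
proof -
  assume X: "padic_null X" and "padic_cauchy Y"
  then obtain L where "(\<lambda>n. padic_abs p (Y n)) \<longlonglongrightarrow> L"
    using padic_cauchy_abs_convergent unfolding convergent_def by blast
  from tendsto_mult[OF X[unfolded padic_null_def] this] show ?thesis
    by (simp add: padic_null_def padic_abs_mult)
qed

lemma padic_cauchy_add:
  assumes "padic_cauchy X" "padic_cauchy Y" shows "padic_cauchy (\<lambda>n. X n + Y n)"
  unfolding padic_cauchy_def
proof (intro allI impI)
  fix e :: real assume e: "e > 0"
  obtain M where M: "\<forall>m\<ge>M. \<forall>n\<ge>M. padic_abs p (X m - X n) < e"
    using assms(1) e unfolding padic_cauchy_def by blast
  obtain N where N: "\<forall>m\<ge>N. \<forall>n\<ge>N. padic_abs p (Y m - Y n) < e"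
    using assms(2) e unfolding padic_cauchy_def by blast
  have "padic_abs p (X m + Y m - (X n + Y n)) < e" if "m \<ge> max M N" "n \<ge> max M N" for m n
  proof -
    have "X m + Y m - (X n + Y n) = (X m - X n) + (Y m - Y n)" by simp
    then show ?thesis using padic_abs_add[of "X m - X n" "Y m - Y n"] M N that
      by (smt (verit) max.bounded_iff)
  qed
  then show "\<exists>M. \<forall>m\<ge>M. \<forall>n\<ge>M. padic_abs p (X m + Y m - (X n + Y n)) < e" by blast
qed

lemma padic_cauchy_minus: "padic_cauchy X \<Longrightarrow> padic_cauchy (\<lambda>n. - X n)"
proof -
  have "padic_abs p (- X m - - X n) = padic_abs p (X m - X n)" for m n
    using padic_abs_minus[of "X m - X n"] by (simp only: minus_diff_minus)
  then show "padic_cauchy X \<Longrightarrow> padic_cauchy (\<lambda>n. - X n)" by (simp only: padic_cauchy_def)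
qed

lemma padic_cauchy_mult:
  assumes "padic_cauchy X" "padic_cauchy Y" shows "padic_cauchy (\<lambda>n. X n * Y n)"
proof -
  have "\<exists>K>0. \<forall>n. padic_abs p (Z n) \<le> K" if "padic_cauchy Z" for Z
    using convergent_imp_Bseq[OF padic_cauchy_abs_convergent[OF that]]
    unfolding Bseq_def by (auto simp: padic_abs_nonneg)
  then obtain K L where K: "K > 0" "\<And>n. padic_abs p (X n) \<le> K"
    and L: "L > 0" "\<And>n. padic_abs p (Y n) \<le> L" using assms by meson
  show ?thesis unfolding padic_cauchy_def
  proof (intro allI impI)
    fix e :: real assume e: "e > 0"
    obtain M where M: "\<forall>m\<ge>M. \<forall>n\<ge>M. padic_abs p (X m - X n) < e / (2 * L)"
      using assms(1) e L unfolding padic_cauchy_def by (meson divide_pos_pos mult_pos_pos zero_less_numeral)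
    obtain N where N: "\<forall>m\<ge>N. \<forall>n\<ge>N. padic_abs p (Y m - Y n) < e / (2 * K)"
      using assms(2) e K unfolding padic_cauchy_def by (meson divide_pos_pos mult_pos_pos zero_less_numeral)
    have "padic_abs p (X m * Y m - X n * Y n) < e" if mn: "m \<ge> max M N" "n \<ge> max M N" for m n
    proof -
      have "X m * Y m - X n * Y n = X m * (Y m - Y n) + (X m - X n) * Y n"
        by (simp add: algebra_simps)
      then have "padic_abs p (X m * Y m - X n * Y n) \<le>
          padic_abs p (X m) * padic_abs p (Y m - Y n) + padic_abs p (X m - X n) * padic_abs p (Y n)"
        using padic_abs_triangle[of "X m * (Y m - Y n)" "(X m - X n) * Y n"]
        by (simp only: padic_abs_mult)
      also have "\<dots> \<le> K * padic_abs p (Y m - Y n) + padic_abs p (X m - X n) * L"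
        using K L by (intro add_mono mult_mono) (auto simp: padic_abs_nonneg less_imp_le)
      also have "\<dots> < K * (e / (2 * K)) + e / (2 * L) * L"
        using K L M N mn by (intro add_strict_mono mult_strict_left_mono mult_strict_right_mono) auto
      also have "\<dots> = e" using K L by simp
      finally show ?thesis .
    qed
    then show "\<exists>M. \<forall>m\<ge>M. \<forall>n\<ge>M. padic_abs p (X m * Y m - X n * Y n) < e" by blast
  qed
qed

lemma padic_cauchy_abs_limit:
  assumes "padic_cauchy X" "\<not> padic_null X"
  obtains L where "L > 0" "(\<lambda>n. padic_abs p (X n)) \<longlonglongrightarrow> L"
proof -
  obtain L where L: "(\<lambda>n. padic_abs p (X n)) \<longlonglongrightarrow> L"
    using padic_cauchy_abs_convergent[OF assms(1)] by (auto simp: convergent_def)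
  moreover have "L \<ge> 0" using L by (rule LIMSEQ_le_const) (auto simp: padic_abs_nonneg)
  moreover have "L \<noteq> 0" using L assms(2) by (auto simp: padic_null_def)
  ultimately show ?thesis using that[of L] by simp
qed

lemma padic_abs_inverse_diff:
  assumes "x \<noteq> 0" "y \<noteq> 0"
  shows "padic_abs p (inverse x - inverse y) =
    padic_abs p (x - y) * inverse (padic_abs p x) * inverse (padic_abs p y)"
proof -
  have "inverse x - inverse y = (y - x) * inverse x * inverse y"
    using assms by (simp add: field_simps)
  then show ?thesis
    by (simp only: padic_abs_mult padic_abs_inverse padic_abs_minus_commute[of x y])
qed

lemma padic_cauchy_inverse:
  assumes "padic_cauchy X" "\<not> padic_null X"
  shows "padic_cauchy (\<lambda>n. inverse (X n))"
  unfolding padic_cauchy_def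
proof (intro allI impI)
  fix e :: real assume e: "e > 0"
  obtain L where L: "L > 0" "(\<lambda>n. padic_abs p (X n)) \<longlonglongrightarrow> L"
    using padic_cauchy_abs_limit[OF assms] .
  have "eventually (\<lambda>n. padic_abs p (X n) > L / 2) sequentially"
    using order_tendstoD(1)[OF L(2), of "L/2"] L(1) by simp
  then obtain N where N: "\<And>n. n \<ge> N \<Longrightarrow> padic_abs p (X n) > L / 2"
    unfolding eventually_sequentially by blast
  have "e * (L/2) * (L/2) > 0" using e L by simp
  then obtain M where M: "\<forall>m\<ge>M. \<forall>n\<ge>M. padic_abs p (X m - X n) < e * (L/2) * (L/2)"
    using assms(1) unfolding padic_cauchy_def by blast
  have "padic_abs p (inverse (X m) - inverse (X n)) < e" if mn: "m \<ge> max M N" "n \<ge> max M N" for m n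
  proof -
    have gt: "padic_abs p (X m) > L/2" "padic_abs p (X n) > L/2" using N mn by auto
    then have nz: "X m \<noteq> 0" "X n \<noteq> 0" using L padic_abs_0 by auto
    have "padic_abs p (X m - X n) < e * (L/2) * (L/2)" using M mn by auto
    also have "\<dots> \<le> e * padic_abs p (X m) * padic_abs p (X n)"
      using gt e L by (intro mult_mono) auto
    finally show ?thesis
      unfolding padic_abs_inverse_diff[OF nz] using gt L by (simp add: field_simps)
  qed
  then show "\<exists>M. \<forall>m\<ge>M. \<forall>n\<ge>M. padic_abs p (inverse (X m) - inverse (X n)) < e" by blast
qed

lemma padic_null_inverse_diff:
  assumes X: "padic_cauchy X" "\<not> padic_null X" and Y: "padic_cauchy Y" "\<not> padic_null Y"
    and XY: "padic_null (\<lambda>n. X n - Y n)"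
  shows "padic_null (\<lambda>n. inverse (X n) - inverse (Y n))"
proof -
  obtain L where L: "L > 0" "(\<lambda>n. padic_abs p (X n)) \<longlonglongrightarrow> L"
    using padic_cauchy_abs_limit[OF X] .
  obtain K where K: "K > 0" "(\<lambda>n. padic_abs p (Y n)) \<longlonglongrightarrow> K"
    using padic_cauchy_abs_limit[OF Y] .
  have lim: "(\<lambda>n. padic_abs p (X n - Y n) * inverse (padic_abs p (X n)) * inverse (padic_abs p (Y n)))
      \<longlonglongrightarrow> 0 * inverse L * inverse K"
    using XY L K unfolding padic_null_def by (intro tendsto_intros) auto
  have "eventually (\<lambda>n. padic_abs p (X n) > 0) sequentially"
    "eventually (\<lambda>n. padic_abs p (Y n) > 0) sequentially"
    using order_tendstoD(1)[OF L(2) L(1)] order_tendstoD(1)[OF K(2) K(1)] by auto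
  then have ev: "eventually (\<lambda>n. padic_abs p (X n - Y n) * inverse (padic_abs p (X n)) *
      inverse (padic_abs p (Y n)) = padic_abs p (inverse (X n) - inverse (Y n))) sequentially"
  proof eventually_elim
    case (elim n)
    then have "X n \<noteq> 0" "Y n \<noteq> 0" using padic_abs_0 by auto
    then show ?case by (simp add: padic_abs_inverse_diff)
  qed
  show ?thesis unfolding padic_null_def
    using Lim_transform_eventually[OF lim ev] by simp
qed

end

subsection \<open>The completion\<close>

text \<open>The prime \<open>p\<close> is passed as the cardinality of a type parameter, so that for each
  \<open>p\<close> there is a type of \<open>p\<close>-adic numbers on which the topology of the library is available.\<close>

class prime_card =
  assumes prime_CARD: "prime CARD('a)"

instance bool :: prime_card
  by standard simp

definition padic_rel :: "nat \<Rightarrow> ((nat \<Rightarrow> rat) \<times> (nat \<Rightarrow> rat)) set" where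
  "padic_rel p = {(X, Y). padic_cauchy p X \<and> padic_cauchy p Y \<and> padic_null p (\<lambda>n. X n - Y n)}"

lemma equiv_padic_rel:
  assumes p: "prime p"
  shows "equiv {X. padic_cauchy p X} (padic_rel p)"
proof (rule equivI)
  show "padic_rel p \<subseteq> {X. padic_cauchy p X} \<times> {X. padic_cauchy p X}"
    by (auto simp: padic_rel_def)
  show "refl_on {X. padic_cauchy p X} (padic_rel p)"
    by (auto simp: padic_rel_def refl_on_def padic_null_0[OF p])
  show "sym (padic_rel p)"
    by (auto simp: padic_rel_def sym_def dest: padic_null_minus[OF p])
  show "trans (padic_rel p)"
  proof (rule transI)
    fix X Y Z assume "(X, Y) \<in> padic_rel p" "(Y, Z) \<in> padic_rel p"
    then show "(X, Z) \<in> padic_rel p"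
      using padic_null_add[OF p, of "\<lambda>n. X n - Y n" "\<lambda>n. Y n - Z n"]
      by (auto simp: padic_rel_def)
  qed
qed

typedef (overloaded) 'p padic = "{X. padic_cauchy CARD('p::prime_card) X} // padic_rel CARD('p)"
  using padic_cauchy_const[OF prime_CARD] by (auto simp: quotient_def)

definition padic_of_seq :: "(nat \<Rightarrow> rat) \<Rightarrow> 'p::prime_card padic" where
  "padic_of_seq X = Abs_padic (padic_rel CARD('p) `` {X})"

definition seq_of_padic :: "'p::prime_card padic \<Rightarrow> nat \<Rightarrow> rat" where
  "seq_of_padic x = (SOME X. padic_cauchy CARD('p) X \<and> padic_of_seq X = x)"

lemma padic_of_seq_eq_iff:
  assumes "padic_cauchy CARD('p::prime_card) X" "padic_cauchy CARD('p) Y"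
  shows "(padic_of_seq X :: 'p padic) = padic_of_seq Y \<longleftrightarrow> padic_null CARD('p) (\<lambda>n. X n - Y n)"
proof -
  note eq = equiv_padic_rel[OF prime_CARD[where 'a='p]]
  have "padic_rel CARD('p) `` {X} \<in> {X. padic_cauchy CARD('p) X} // padic_rel CARD('p)"
    "padic_rel CARD('p) `` {Y} \<in> {X. padic_cauchy CARD('p) X} // padic_rel CARD('p)"
    using assms by (auto intro: quotientI)
  then show ?thesis
    using eq_equiv_class_iff[OF eq, of X Y] assms
    by (simp add: padic_of_seq_def Abs_padic_inject) (simp add: padic_rel_def)
qed

lemma seq_of_padic:
  "padic_cauchy CARD('p) (seq_of_padic x)" "padic_of_seq (seq_of_padic x) = (x :: 'p::prime_card padic)"
proof -
  have "Rep_padic x \<in> {X. padic_cauchy CARD('p) X} // padic_rel CARD('p)" by (rule Rep_padic)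
  then obtain X where "padic_cauchy CARD('p) X" "Rep_padic x = padic_rel CARD('p) `` {X}"
    by (auto elim: quotientE)
  then have "\<exists>X. padic_cauchy CARD('p) X \<and> padic_of_seq X = x"
    unfolding padic_of_seq_def using Rep_padic_inverse[of x] by auto
  from someI_ex[OF this]
  show "padic_cauchy CARD('p) (seq_of_padic x)" "padic_of_seq (seq_of_padic x) = x"
    by (simp_all add: seq_of_padic_def)
qed

lemma padic_seqE:
  obtains X where "padic_cauchy CARD('p) X" "(x :: 'p::prime_card padic) = padic_of_seq X"
  using seq_of_padic[of x] by metis

lemma seq_of_padic_of_seq:
  assumes "padic_cauchy CARD('p::prime_card) X"
  shows "padic_null CARD('p) (\<lambda>n. seq_of_padic (padic_of_seq X :: 'p padic) n - X n)"
  using padic_of_seq_eq_iff[OF seq_of_padic(1) assms] seq_of_padic(2) by blast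

instantiation padic :: (prime_card) field
begin

definition "0 = padic_of_seq (\<lambda>n. 0)"
definition "1 = padic_of_seq (\<lambda>n. 1)"
definition "x + y = padic_of_seq (\<lambda>n. seq_of_padic x n + seq_of_padic y n)"
definition "x * y = padic_of_seq (\<lambda>n. seq_of_padic x n * seq_of_padic y n)"
definition "- x = padic_of_seq (\<lambda>n. - seq_of_padic x n)"
definition "(x :: 'a padic) - y = x + - y"
definition "inverse (x :: 'a padic) =
  (if x = 0 then 0 else padic_of_seq (\<lambda>n. inverse (seq_of_padic x n)))"
definition "(x :: 'a padic) div y = x * inverse y"

lemma padic_of_seq_add:
  assumes X: "padic_cauchy CARD('a) X" and Y: "padic_cauchy CARD('a) Y"
  shows "(padic_of_seq X :: 'a padic) + padic_of_seq Y = padic_of_seq (\<lambda>n. X n + Y n)"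
proof -
  note p = prime_CARD[where 'a='a]
  let ?X = "seq_of_padic (padic_of_seq X :: 'a padic)" and ?Y = "seq_of_padic (padic_of_seq Y :: 'a padic)"
  have "padic_null CARD('a) (\<lambda>n. (?X n - X n) + (?Y n - Y n))"
    by (rule padic_null_add[OF p seq_of_padic_of_seq[OF X] seq_of_padic_of_seq[OF Y]])
  moreover have eq: "(\<lambda>n. (?X n - X n) + (?Y n - Y n)) = (\<lambda>n. ?X n + ?Y n - (X n + Y n))"
    by auto
  ultimately show ?thesis
    unfolding plus_padic_def eq
    by (simp only: padic_of_seq_eq_iff padic_cauchy_add[OF p] seq_of_padic(1) assms)
qed

lemma padic_of_seq_mult:
  assumes X: "padic_cauchy CARD('a) X" and Y: "padic_cauchy CARD('a) Y"
  shows "(padic_of_seq X :: 'a padic) * padic_of_seq Y = padic_of_seq (\<lambda>n. X n * Y n)"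
proof -
  note p = prime_CARD[where 'a='a]
  let ?X = "seq_of_padic (padic_of_seq X :: 'a padic)" and ?Y = "seq_of_padic (padic_of_seq Y :: 'a padic)"
  have "padic_null CARD('a) (\<lambda>n. (?X n - X n) * ?Y n + (?Y n - Y n) * X n)"
    by (rule padic_null_add[OF p padic_null_mult[OF p seq_of_padic_of_seq[OF X] seq_of_padic(1)]
        padic_null_mult[OF p seq_of_padic_of_seq[OF Y] X]])
  moreover have eq: "(\<lambda>n. (?X n - X n) * ?Y n + (?Y n - Y n) * X n) = (\<lambda>n. ?X n * ?Y n - X n * Y n)"
    by (simp add: algebra_simps)
  ultimately show ?thesis
    unfolding times_padic_def eq
    by (simp only: padic_of_seq_eq_iff padic_cauchy_mult[OF p] seq_of_padic(1) assms)
qed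

lemma padic_of_seq_minus:
  assumes X: "padic_cauchy CARD('a) X"
  shows "- (padic_of_seq X :: 'a padic) = padic_of_seq (\<lambda>n. - X n)"
proof -
  note p = prime_CARD[where 'a='a]
  let ?X = "seq_of_padic (padic_of_seq X :: 'a padic)"
  have "padic_null CARD('a) (\<lambda>n. - (?X n - X n))"
    using assms by (intro padic_null_minus[OF p] seq_of_padic_of_seq)
  moreover have eq: "(\<lambda>n. - (?X n - X n)) = (\<lambda>n. - ?X n - - X n)"
    by auto
  ultimately show ?thesis
    unfolding uminus_padic_def eq
    by (simp only: padic_of_seq_eq_iff padic_cauchy_minus[OF p] seq_of_padic(1) assms)
qed

lemma padic_of_seq_eq_0_iff:
  "padic_cauchy CARD('a) X \<Longrightarrow> (padic_of_seq X :: 'a padic) = 0 \<longleftrightarrow> padic_null CARD('a) X"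
  unfolding zero_padic_def
  by (subst padic_of_seq_eq_iff) (auto intro: padic_cauchy_const[OF prime_CARD])

lemma padic_of_seq_inverse:
  assumes X: "padic_cauchy CARD('a) X" and nz: "\<not> padic_null CARD('a) X"
  shows "inverse (padic_of_seq X :: 'a padic) = padic_of_seq (\<lambda>n. inverse (X n))"
proof -
  note p = prime_CARD[where 'a='a]
  let ?X = "seq_of_padic (padic_of_seq X :: 'a padic)"
  have nz': "(padic_of_seq X :: 'a padic) \<noteq> 0" using padic_of_seq_eq_0_iff[OF X] nz by simp
  then have nz'': "\<not> padic_null CARD('a) ?X"
    using padic_of_seq_eq_0_iff[OF seq_of_padic(1)] by (simp add: seq_of_padic(2))
  have "padic_null CARD('a) (\<lambda>n. inverse (?X n) - inverse (X n))"
    by (rule padic_null_inverse_diff[OF p seq_of_padic(1) nz'' X nz seq_of_padic_of_seq[OF X]])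
  then have "(padic_of_seq (\<lambda>n. inverse (?X n)) :: 'a padic) = padic_of_seq (\<lambda>n. inverse (X n))"
    using assms nz'' by (subst padic_of_seq_eq_iff) (auto intro!: padic_cauchy_inverse[OF p] seq_of_padic(1))
  then show ?thesis using nz' by (simp add: inverse_padic_def)
qed

instance
proof
  note p = prime_CARD[where 'a='a]
  note C = padic_cauchy_add[OF p] padic_cauchy_mult[OF p] padic_cauchy_minus[OF p] padic_cauchy_const[OF p]
  note S = padic_of_seq_add padic_of_seq_mult padic_of_seq_minus
  fix a b c :: "'a padic"
  obtain A where A: "padic_cauchy CARD('a) A" "a = padic_of_seq A" by (rule padic_seqE)
  obtain B where B: "padic_cauchy CARD('a) B" "b = padic_of_seq B" by (rule padic_seqE)
  obtain D where D: "padic_cauchy CARD('a) D" "c = padic_of_seq D" by (rule padic_seqE)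
  show "a * b * c = a * (b * c)" using A B D C by (simp add: S algebra_simps)
  show "a * b = b * a" using A B C by (simp add: S algebra_simps)
  show "1 * a = a" using A C by (simp add: S one_padic_def)
  show "a + b + c = a + (b + c)" using A B D C by (simp add: S algebra_simps)
  show "a + b = b + a" using A B C by (simp add: S algebra_simps)
  show "0 + a = a" using A C by (simp add: S zero_padic_def)
  show "- a + a = 0" using A C by (simp add: S zero_padic_def)
  show "a - b = a + - b" by (simp add: minus_padic_def)
  show "(a + b) * c = a * c + b * c" using A B D C by (simp add: S algebra_simps)
  show "(0 :: 'a padic) \<noteq> 1"
  proof -
    have "\<not> padic_null CARD('a) (\<lambda>n. 1)"
      by (simp add: padic_null_def[OF p] padic_abs_1[OF p] LIMSEQ_const_iff)
    then show ?thesis using padic_of_seq_eq_0_iff[OF C(4)[of 1]] by (simp add: one_padic_def)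
  qed
  show "a div b = a * inverse b" by (simp add: divide_padic_def)
  show "inverse (0 :: 'a padic) = 0" by (simp add: inverse_padic_def)
  show "inverse a * a = 1" if "a \<noteq> 0"
  proof -
    have nz: "\<not> padic_null CARD('a) A" using that A padic_of_seq_eq_0_iff by auto
    obtain L where L: "L > 0" "(\<lambda>n. padic_abs CARD('a) (A n)) \<longlonglongrightarrow> L"
      using padic_cauchy_abs_limit[OF p A(1) nz] .
    have "eventually (\<lambda>n. padic_abs CARD('a) (A n) > 0) sequentially"
      using order_tendstoD(1)[OF L(2) L(1)] .
    then have "eventually (\<lambda>n. padic_abs CARD('a) (inverse (A n) * A n - 1) = 0) sequentially"
      by eventually_elim (use padic_abs_0[OF p] in \<open>auto simp: field_simps\<close>)
    then have "padic_null CARD('a) (\<lambda>n. inverse (A n) * A n - 1)"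
      unfolding padic_null_def[OF p] by (rule tendsto_eventually)
    moreover note I = padic_cauchy_inverse[OF p A(1) nz]
    ultimately show ?thesis
      unfolding A(2) padic_of_seq_inverse[OF A(1) nz] padic_of_seq_mult[OF I A(1)] one_padic_def
      by (subst padic_of_seq_eq_iff) (auto intro: C I A)
  qed
qed

end

subsection \<open>Absolute value and topology\<close>

definition padic_norm :: "'p::prime_card padic \<Rightarrow> real" where
  "padic_norm x = lim (\<lambda>n. padic_abs CARD('p) (seq_of_padic x n))"

lemma padic_norm_of_seq:
  assumes X: "padic_cauchy CARD('p::prime_card) X"
  shows "(\<lambda>n. padic_abs CARD('p) (X n)) \<longlonglongrightarrow> padic_norm (padic_of_seq X :: 'p::prime_card padic)"
proof -
  note p = prime_CARD[where 'a='p]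
  let ?X = "seq_of_padic (padic_of_seq X :: 'p::prime_card padic)"
  have lim: "(\<lambda>n. padic_abs CARD('p) (?X n)) \<longlonglongrightarrow> padic_norm (padic_of_seq X :: 'p::prime_card padic)"
    unfolding padic_norm_def using padic_cauchy_abs_convergent[OF p seq_of_padic(1)]
    by (simp add: convergent_LIMSEQ_iff)
  have "(\<lambda>n. padic_abs CARD('p) (?X n - X n)) \<longlonglongrightarrow> 0"
    using seq_of_padic_of_seq[OF X] by (simp add: padic_null_def[OF p])
  then have "(\<lambda>n. padic_abs CARD('p) (X n) - padic_abs CARD('p) (?X n)) \<longlonglongrightarrow> 0"
    by (rule Lim_null_comparison[rotated])
       (metis (no_types, lifting) always_eventually padic_abs_diff_triangle[OF p]
         padic_abs_minus_commute[OF p] real_norm_def)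
  from tendsto_add[OF this lim] show ?thesis by simp
qed

lemma padic_norm_nonneg: "padic_norm (x :: 'p::prime_card padic) \<ge> 0"
proof -
  obtain X where X: "padic_cauchy CARD('p) X" "x = padic_of_seq X" by (rule padic_seqE)
  show ?thesis unfolding X(2) using padic_norm_of_seq[OF X(1)]
    by (rule LIMSEQ_le_const) (auto simp: padic_abs_nonneg[OF prime_CARD])
qed

lemma padic_norm_eq_0_iff: "padic_norm (x :: 'p::prime_card padic) = 0 \<longleftrightarrow> x = 0"
proof -
  obtain X where X: "padic_cauchy CARD('p) X" "x = padic_of_seq X" by (rule padic_seqE)
  show ?thesis unfolding X(2) padic_of_seq_eq_0_iff[OF X(1)] padic_null_def[OF prime_CARD]
    using padic_norm_of_seq[OF X(1)] LIMSEQ_unique by metis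
qed

lemma padic_norm_mult: "padic_norm (x * y :: 'p::prime_card padic) = padic_norm x * padic_norm y"
proof -
  note p = prime_CARD[where 'a='p]
  obtain X where X: "padic_cauchy CARD('p) X" "x = padic_of_seq X" by (rule padic_seqE)
  obtain Y where Y: "padic_cauchy CARD('p) Y" "y = padic_of_seq Y" by (rule padic_seqE)
  have "(\<lambda>n. padic_abs CARD('p) (X n) * padic_abs CARD('p) (Y n)) \<longlonglongrightarrow> padic_norm x * padic_norm y"
    unfolding X(2) Y(2) by (intro tendsto_mult padic_norm_of_seq X Y)
  moreover have "(\<lambda>n. padic_abs CARD('p) (X n) * padic_abs CARD('p) (Y n)) \<longlonglongrightarrow> padic_norm (x * y)"
    using padic_norm_of_seq[OF padic_cauchy_mult[OF p X(1) Y(1)]]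
    by (simp add: padic_abs_mult[OF p] X Y padic_of_seq_mult)
  ultimately show ?thesis using LIMSEQ_unique by blast
qed

lemma padic_norm_minus: "padic_norm (- x :: 'p::prime_card padic) = padic_norm x"
proof -
  note p = prime_CARD[where 'a='p]
  obtain X where X: "padic_cauchy CARD('p) X" "x = padic_of_seq X" by (rule padic_seqE)
  have "(\<lambda>n. padic_abs CARD('p) (X n)) \<longlonglongrightarrow> padic_norm (- x)"
    using padic_norm_of_seq[OF padic_cauchy_minus[OF p X(1)]]
    by (simp add: padic_abs_minus[OF p] X padic_of_seq_minus)
  then show ?thesis
    unfolding X(2) by (rule LIMSEQ_unique[OF _ padic_norm_of_seq[OF X(1)]])
qed

lemma padic_norm_add: "padic_norm (x + y :: 'p::prime_card padic) \<le> max (padic_norm x) (padic_norm y)"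
proof -
  note p = prime_CARD[where 'a='p]
  obtain X where X: "padic_cauchy CARD('p) X" "x = padic_of_seq X" by (rule padic_seqE)
  obtain Y where Y: "padic_cauchy CARD('p) Y" "y = padic_of_seq Y" by (rule padic_seqE)
  have lim1: "(\<lambda>n. max (padic_abs CARD('p) (X n)) (padic_abs CARD('p) (Y n))) \<longlonglongrightarrow> max (padic_norm x) (padic_norm y)"
    unfolding X(2) Y(2) by (intro tendsto_max padic_norm_of_seq X Y)
  have lim2: "(\<lambda>n. padic_abs CARD('p) (X n + Y n)) \<longlonglongrightarrow> padic_norm (x + y)"
    using padic_norm_of_seq[OF padic_cauchy_add[OF p X(1) Y(1)]]
    by (simp add: X Y padic_of_seq_add)
  show ?thesis
    by (rule LIMSEQ_le[OF lim2 lim1]) (auto simp: padic_abs_add[OF p])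
qed

instantiation padic :: (prime_card) metric_space
begin

definition dist_padic :: "'a padic \<Rightarrow> 'a padic \<Rightarrow> real" where
  "dist_padic x y = padic_norm (x - y)"

definition uniformity_padic :: "('a padic \<times> 'a padic) filter" where
  "uniformity_padic = (INF e\<in>{0<..}. principal {(x, y). dist x y < e})"

definition open_padic :: "'a padic set \<Rightarrow> bool" where
  "open_padic U = (\<forall>x\<in>U. eventually (\<lambda>(x', y). x' = x \<longrightarrow> y \<in> U) uniformity)"

instance
proof
  fix x y z :: "'a padic" and U :: "'a padic set"
  show "uniformity = (INF e\<in>{0 <..}. principal {(x :: 'a padic, y). dist x y < e})"
    by (rule uniformity_padic_def)
  show "open U = (\<forall>x\<in>U. \<forall>\<^sub>F (x', y) in uniformity. x' = x \<longrightarrow> y \<in> U)"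
    by (rule open_padic_def)
  show "dist x y = 0 \<longleftrightarrow> x = y" by (simp add: dist_padic_def padic_norm_eq_0_iff)
  have "padic_norm (x - y) \<le> max (padic_norm (x - z)) (padic_norm (y - z))"
    using padic_norm_add[of "x - z" "z - y"] padic_norm_minus[of "y - z"] by simp
  then show "dist x y \<le> dist x z + dist y z"
    using padic_norm_nonneg[of "x - z"] padic_norm_nonneg[of "y - z"] by (simp add: dist_padic_def)
qed

end

lemma padic_norm_0 [simp]: "padic_norm (0 :: 'p::prime_card padic) = 0"
  by (simp add: padic_norm_eq_0_iff)

lemma padic_norm_1 [simp]: "padic_norm (1 :: 'p::prime_card padic) = 1"
proof -
  have "padic_norm (1 :: 'p padic) * padic_norm (1 :: 'p padic) = padic_norm (1 :: 'p padic)"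
    by (metis mult_1 padic_norm_mult)
  then show ?thesis by (simp add: padic_norm_eq_0_iff)
qed

lemma padic_norm_inverse: "padic_norm (inverse x) = inverse (padic_norm (x :: 'p::prime_card padic))"
proof (cases "x = 0")
  case False
  then have "padic_norm x * padic_norm (inverse x) = 1"
    by (simp add: padic_norm_mult[symmetric])
  then show ?thesis by (metis inverse_unique)
qed simp

lemma padic_norm_add_le:
  "padic_norm x \<le> c \<Longrightarrow> padic_norm y \<le> c \<Longrightarrow> padic_norm (x + y :: 'p::prime_card padic) \<le> c"
  using padic_norm_add[of x y] by simp

lemma padic_norm_diff_le:
  "padic_norm x \<le> c \<Longrightarrow> padic_norm y \<le> c \<Longrightarrow> padic_norm (x - y :: 'p::prime_card padic) \<le> c"
  using padic_norm_add[of x "- y"] padic_norm_minus[of y] by simp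

lemma padic_norm_mult_le:
  "padic_norm x \<le> 1 \<Longrightarrow> padic_norm y \<le> c \<Longrightarrow> padic_norm (x * y :: 'p::prime_card padic) \<le> c"
  using mult_mono[of "padic_norm x" 1 "padic_norm y" c] padic_norm_nonneg[of y]
  by (simp add: padic_norm_mult)

lemma padic_norm_diff_commute: "padic_norm (x - y) = padic_norm (y - x :: 'p::prime_card padic)"
  using padic_norm_minus[of "x - y"] by simp

lemma of_int_padic: "(of_int k :: 'p::prime_card padic) = padic_of_seq (\<lambda>n. of_int k)"
proof -
  note C = padic_cauchy_const[OF prime_CARD[where 'a='p]]
  have nat: "(of_nat j :: 'p padic) = padic_of_seq (\<lambda>n. of_nat j)" for j
    by (induction j)
       (use C in \<open>auto simp: zero_padic_def one_padic_def padic_of_seq_add\<close>)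
  show ?thesis
    by (cases k rule: int_cases2) (use C in \<open>auto simp: nat padic_of_seq_minus\<close>)
qed

lemma padic_norm_of_int: "padic_norm (of_int k :: 'p::prime_card padic) = padic_abs CARD('p) (of_int k)"
  using padic_norm_of_seq[where 'p='p, OF padic_cauchy_const[OF prime_CARD], of "of_int k"]
  by (simp add: of_int_padic LIMSEQ_const_iff)

lemma padic_abs_of_int_le_iff:
  assumes p: "prime p"
  shows "padic_abs p (of_int k) \<le> 1 / real p ^ m \<longleftrightarrow> int p ^ m dvd k"
proof (cases "k = 0")
  case False
  have gt: "real p > 1" using p_gt_1[OF p] .
  have "padic_abs p (of_int k) = real p powi (- int (multiplicity (int p) k))"
    using padic_abs_Fract[OF p False, of 1] by (simp add: of_int_rat)
  also have "\<dots> \<le> 1 / real p ^ m \<longleftrightarrow> real p ^ m \<le> real p ^ multiplicity (int p) k"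
    using gt by (simp add: power_int_minus field_simps)
  also have "\<dots> \<longleftrightarrow> m \<le> multiplicity (int p) k"
    using gt by (simp add: power_increasing_iff)
  also have "\<dots> \<longleftrightarrow> int p ^ m dvd k"
    using False prime_gt_1_nat[OF p] by (subst power_dvd_iff_le_multiplicity) auto
  finally show ?thesis .
qed (simp add: padic_abs_0[OF p])

lemma padic_norm_of_int_le_iff:
  "padic_norm (of_int k :: 'p::prime_card padic) \<le> 1 / real CARD('p) ^ m \<longleftrightarrow> int CARD('p) ^ m dvd k"
  by (simp add: padic_norm_of_int padic_abs_of_int_le_iff[OF prime_CARD])

lemma padic_abs_approx_int:
  assumes p: "prime p" and x: "padic_abs p x \<le> 1"
  shows "\<exists>k. padic_abs p (x - of_int k) \<le> 1 / real p ^ m"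
proof (cases "x = 0")
  case False
  have gt: "real p > 1" using p_gt_1[OF p] .
  obtain a b where ab: "x = Fract a b" "b > 0" "coprime a b" by (cases x) auto
  have a: "a \<noteq> 0" using False ab by (auto simp: Zero_rat_def eq_rat)
  have ndvd: "\<not> int p dvd b"
  proof
    assume dvd: "int p dvd b"
    then have na: "\<not> int p dvd a"
      using ab(3) p by (metis coprime_common_divisor not_prime_unit prime_nat_int_transfer)
    have "multiplicity (int p) b > 0"
      using dvd ab p by (simp add: prime_multiplicity_gt_zero_iff)
    moreover have "multiplicity (int p) a = 0" using na by (rule not_dvd_imp_multiplicity_0)
    ultimately have "padic_abs p x > 1"
      using padic_abs_Fract[OF p a, of b] ab gt by (simp add: one_less_power)
    then show False using x by simp
  qed
  then have "coprime b (int p ^ m)"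
    using p by (metis coprime_commute coprime_power_right_iff prime_imp_coprime prime_nat_int_transfer)
  then obtain c where "[b * c = 1] (mod int p ^ m)" using cong_solve_coprime_int by blast
  then have "int p ^ m dvd b * c - 1" by (simp add: cong_iff_dvd_diff)
  then have "int p ^ m dvd a * (b * c - 1)" by simp
  then have dvd: "int p ^ m dvd a - b * (a * c)"
    by (subst dvd_minus_iff[symmetric]) (simp add: algebra_simps)
  have eq: "x - of_int (a * c) = of_int (a - b * (a * c)) * inverse (of_int b)"
    using ab by (simp add: Fract_of_int_quotient field_simps)
  have "padic_abs p (of_int b) = 1"
    using padic_abs_Fract[OF p, of b 1] ab not_dvd_imp_multiplicity_0[OF ndvd]
    by (simp add: of_int_rat)
  then have "padic_abs p (x - of_int (a * c)) = padic_abs p (of_int (a - b * (a * c)))"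
    unfolding eq by (simp add: padic_abs_mult[OF p] padic_abs_inverse[OF p])
  then show ?thesis using padic_abs_of_int_le_iff[OF p] dvd by metis
qed (auto simp: padic_abs_0[OF p] intro: exI[of _ 0])

lemma padic_abs_less_p:
  assumes p: "prime p" and "padic_abs p x < real p"
  shows "padic_abs p x \<le> 1"
proof (cases "x = 0")
  case False
  have gt: "real p > 1" using p_gt_1[OF p] .
  obtain a b where x: "x = Fract a b" "b > 0" by (cases x) auto
  have "a \<noteq> 0" using False x by (auto simp: Zero_rat_def eq_rat)
  then obtain e where e: "padic_abs p x = real p powi e"
    using padic_abs_Fract[OF p, of a b] x by auto
  then have "real p powi e < real p powi 1" using assms by simp
  then have "e < 1" using gt power_int_increasing[of 1 e "real p"] by (meson less_le_not_le linorder_not_less less_imp_le)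
  then show ?thesis unfolding e using gt power_int_increasing[of e 0 "real p"] by simp
qed (simp add: padic_abs_0[OF p])

lemma padic_approx_int:
  assumes x: "padic_norm (x :: 'p::prime_card padic) \<le> 1"
  shows "\<exists>k. padic_norm (x - of_int k) \<le> 1 / real CARD('p) ^ m"
proof -
  let ?p = "CARD('p)"
  note p = prime_CARD[where 'a='p]
  have gt: "real ?p > 1" using p_gt_1[OF p] .
  obtain X where X: "padic_cauchy ?p X" "x = padic_of_seq X" by (rule padic_seqE)
  have "eventually (\<lambda>n. padic_abs ?p (X n) < real ?p) sequentially"
    using order_tendstoD(2)[OF padic_norm_of_seq[OF X(1)]] x gt X(2) by simp
  then obtain M where M: "\<And>n. n \<ge> M \<Longrightarrow> padic_abs ?p (X n) < real ?p"
    unfolding eventually_sequentially by blast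
  have "1 / real ?p ^ m > 0" using gt by simp
  then obtain N where N: "\<forall>k\<ge>N. \<forall>n\<ge>N. padic_abs ?p (X k - X n) < 1 / real ?p ^ m"
    using X(1) unfolding padic_cauchy_def[OF p] by blast
  define K where "K = max M N"
  have "padic_abs ?p (X K) \<le> 1" using padic_abs_less_p[OF p M[of K]] by (simp add: K_def)
  then obtain k where k: "padic_abs ?p (X K - of_int k) \<le> 1 / real ?p ^ m"
    using padic_abs_approx_int[OF p] by blast
  have le: "padic_abs ?p (X n - of_int k) \<le> 1 / real ?p ^ m" if "n \<ge> K" for n
  proof -
    have "X n - of_int k = (X n - X K) + (X K - of_int k)" by simp
    moreover have "padic_abs ?p (X n - X K) < 1 / real ?p ^ m"
      using N that by (simp add: K_def)
    ultimately show ?thesis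
      using padic_abs_add[OF p, of "X n - X K" "X K - of_int k"] k by simp
  qed
  note C = padic_cauchy_const[OF p]
  have "padic_cauchy ?p (\<lambda>n. X n + - of_int k)" by (rule padic_cauchy_add[OF p X(1) C])
  from padic_norm_of_seq[OF this]
  have "(\<lambda>n. padic_abs ?p (X n - of_int k)) \<longlonglongrightarrow> padic_norm (x - of_int k)"
    using X C by (simp add: of_int_padic padic_of_seq_minus padic_of_seq_add flip: add_uminus_conv_diff)
  then have "padic_norm (x - of_int k) \<le> 1 / real ?p ^ m"
    by (rule LIMSEQ_le_const2) (use le in blast)
  then show ?thesis by blast
qed

subsection \<open>Reduction modulo \<open>p\<^sup>m\<close>\<close>

text \<open>The ring \<open>\<int>/p\<^sup>m\<int>\<close> is represented by the residues \<open>0, \<dots>, p\<^sup>m - 1\<close>. The value is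
  meaningful for \<open>padic_norm x \<le> 1\<close>.\<close>

definition padic_mod :: "nat \<Rightarrow> 'p::prime_card padic \<Rightarrow> int" where
  "padic_mod m x =
     (THE k. k \<in> {0..<int CARD('p) ^ m} \<and> padic_norm (x - of_int k) \<le> 1 / real CARD('p) ^ m)"

lemma padic_mod_eqI:
  assumes k: "padic_norm (x - of_int k :: 'p::prime_card padic) \<le> 1 / real CARD('p) ^ m"
  shows "padic_mod m x = k mod int CARD('p) ^ m"
proof -
  let ?q = "int CARD('p) ^ m"
  have q: "?q > 0" using prime_gt_0_nat[OF prime_CARD[where 'a='p]] by simp
  have iff: "padic_norm (x - of_int l) \<le> 1 / real CARD('p) ^ m \<longleftrightarrow> ?q dvd k - l" for l
  proof -
    have "padic_norm (x - of_int l) \<le> 1 / real CARD('p) ^ m \<longleftrightarrow>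
          padic_norm (of_int (k - l) :: 'p padic) \<le> 1 / real CARD('p) ^ m"
      using padic_norm_diff_le[of "x - of_int l" _ "x - of_int k"]
        padic_norm_add_le[of "x - of_int k" _ "of_int (k - l)"] k by auto
    then show ?thesis by (simp only: padic_norm_of_int_le_iff)
  qed
  show ?thesis unfolding padic_mod_def
  proof (rule the_equality)
    show "k mod ?q \<in> {0..<?q} \<and> padic_norm (x - of_int (k mod ?q)) \<le> 1 / real CARD('p) ^ m"
      unfolding iff using q by (simp add: minus_mod_eq_mult_div)
    fix l assume "l \<in> {0..<?q} \<and> padic_norm (x - of_int l) \<le> 1 / real CARD('p) ^ m"
    then have "0 \<le> l" "l < ?q" "?q dvd k - l" unfolding iff by auto
    then show "l = k mod ?q" by (metis mod_eq_dvd_iff mod_pos_pos_trivial)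
  qed
qed

lemma padic_mod:
  assumes "padic_norm (x :: 'p::prime_card padic) \<le> 1"
  shows "padic_mod m x \<in> {0..<int CARD('p) ^ m}"
    and "padic_norm (x - of_int (padic_mod m x)) \<le> 1 / real CARD('p) ^ m"
proof -
  let ?q = "int CARD('p) ^ m"
  have q: "?q > 0" using prime_gt_0_nat[OF prime_CARD[where 'a='p]] by simp
  obtain k where k: "padic_norm (x - of_int k) \<le> 1 / real CARD('p) ^ m" using padic_approx_int[OF assms] by blast
  have eq: "padic_mod m x = k mod ?q" by (rule padic_mod_eqI[OF k])
  then show "padic_mod m x \<in> {0..<?q}" using q by simp
  have "padic_norm (of_int (k - k mod ?q) :: 'p padic) \<le> 1 / real CARD('p) ^ m"
    by (subst padic_norm_of_int_le_iff) (simp add: minus_mod_eq_mult_div)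
  from padic_norm_add_le[OF k this] show "padic_norm (x - of_int (padic_mod m x)) \<le> 1 / real CARD('p) ^ m"
    by (simp add: eq)
qed

lemma padic_mod_mult:
  assumes x: "padic_norm (x :: 'p::prime_card padic) \<le> 1" and y: "padic_norm y \<le> 1"
  shows "padic_mod m (x * y) = (padic_mod m x * padic_mod m y) mod int CARD('p) ^ m"
proof (rule padic_mod_eqI)
  let ?k = "padic_mod m x" and ?l = "padic_mod m y"
  have k: "padic_norm (of_int ?k :: 'p padic) \<le> 1"
    using padic_norm_of_int_le_iff[where 'p='p, of ?k 0] by simp
  have "x * y - of_int (?k * ?l) = y * (x - of_int ?k) + of_int ?k * (y - of_int ?l)"
    by (simp add: algebra_simps)
  then show "padic_norm (x * y - of_int (?k * ?l)) \<le> 1 / real CARD('p) ^ m"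
    using padic_norm_add_le[OF padic_norm_mult_le[OF y padic_mod(2)[OF x]]
        padic_norm_mult_le[OF k padic_mod(2)[OF y]]] by metis
qed

lemma padic_mod_1: "padic_mod m (1 :: 'p::prime_card padic) = 1 mod int CARD('p) ^ m"
  using padic_mod_eqI[of "1 :: 'p padic" 1 m] prime_gt_0_nat[OF prime_CARD[where 'a='p]] by simp


section \<open>Affine space\<close>

definition max_norm :: "('p::prime_card padic ^ 'n::finite) \<Rightarrow> real" where
  "max_norm x = Max (range (\<lambda>i. padic_norm (x $ i)))"

definition max_cball :: "('p::prime_card padic ^ 'n::finite) \<Rightarrow> real \<Rightarrow> ('p padic ^ 'n) set" where
  "max_cball x r = {y. max_norm (x - y) \<le> r}"

definition Zp_vectors :: "('p::prime_card padic ^ 'n::finite) set" where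
  "Zp_vectors = {x. \<forall>i. padic_norm (x $ i) \<le> 1}"

text \<open>The library makes a vector type a metric space by means of the Euclidean combination of the
  coordinate distances. Its topology is the product topology, hence also that of the maximum padic_norm,
  and \<open>borel\<close>, \<open>compact\<close> and \<open>openin\<close> below refer to it. Its balls are not used.\<close>

definition normalized_haar_measure :: "('p::prime_card padic ^ 'n::finite) measure \<Rightarrow> bool" where
  "normalized_haar_measure \<mu> \<longleftrightarrow>
     sets \<mu> = sets borel \<and>
     (\<forall>K. compact K \<longrightarrow> emeasure \<mu> K < \<infinity>) \<and>
     (\<forall>v. \<forall>E\<in>sets borel. emeasure \<mu> ((\<lambda>x. v + x) ` E) = emeasure \<mu> E) \<and>
     emeasure \<mu> Zp_vectors = 1"

subsection \<open>Polynomials, algebraic sets and their dimension\<close>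

definition poly_eval :: "(('n::finite \<Rightarrow>\<^sub>0 nat) \<Rightarrow>\<^sub>0 'a::comm_ring_1) \<Rightarrow> 'a ^ 'n \<Rightarrow> 'a" where
  "poly_eval f x =
     (\<Sum>t\<in>Poly_Mapping.keys f. Poly_Mapping.lookup f t * (\<Prod>i\<in>UNIV. x $ i ^ Poly_Mapping.lookup t i))"

definition homogeneous_poly :: "(('n::finite \<Rightarrow>\<^sub>0 nat) \<Rightarrow>\<^sub>0 'a::comm_ring_1) \<Rightarrow> bool" where
  "homogeneous_poly f \<longleftrightarrow>
     (\<exists>d. \<forall>t\<in>Poly_Mapping.keys f. (\<Sum>i\<in>UNIV. Poly_Mapping.lookup t i) = d)"

definition affine_algebraic :: "('p::prime_card padic ^ 'n::finite) set \<Rightarrow> bool" where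
  "affine_algebraic A \<longleftrightarrow>
     (\<exists>F :: (('n \<Rightarrow>\<^sub>0 nat) \<Rightarrow>\<^sub>0 'p padic) set. A = {x \<in> Zp_vectors. \<forall>f\<in>F. poly_eval f x = 0})"

text \<open>The Krull dimension of a set \<open>A\<close> in the Zariski topology, whose closed sets are given by a
  predicate: the supremum of the lengths \<open>d\<close> of chains \<open>Z 0 \<subset> \<dots> \<subset> Z d\<close> of irreducible closed
  subsets of \<open>A\<close>. The empty set has dimension \<open>-\<infinity>\<close>.\<close>

definition irreducible_closed :: "('a set \<Rightarrow> bool) \<Rightarrow> 'a set \<Rightarrow> bool" where
  "irreducible_closed zclosed Z \<longleftrightarrow> zclosed Z \<and> Z \<noteq> {} \<and>
     (\<forall>X Y. zclosed X \<and> zclosed Y \<and> Z = X \<union> Y \<longrightarrow> Z = X \<or> Z = Y)"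

definition krull_dim :: "('a set \<Rightarrow> bool) \<Rightarrow> 'a set \<Rightarrow> ereal" where
  "krull_dim zclosed A =
     (SUP d \<in> {d. \<exists>Z :: nat \<Rightarrow> 'a set. (\<forall>i\<le>d. irreducible_closed zclosed (Z i) \<and> Z i \<subseteq> A) \<and>
                 (\<forall>i<d. Z i \<subset> Z (Suc i))}. ereal (real d))"

subsection \<open>Volume and number of residues\<close>

definition affine_vol_approx ::
    "('p::prime_card padic ^ 'n::finite) measure \<Rightarrow> nat \<Rightarrow> ('p padic ^ 'n) set \<Rightarrow> nat \<Rightarrow> real" where
  "affine_vol_approx \<mu> a U m =
     real CARD('p) powi (int m * (int CARD('n) - int a)) *
     measure \<mu> (\<Union>x\<in>U. max_cball x (1 / real CARD('p) ^ m))"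

definition affine_vol ::
    "('p::prime_card padic ^ 'n::finite) measure \<Rightarrow> nat \<Rightarrow> ('p padic ^ 'n) set \<Rightarrow> real" where
  "affine_vol \<mu> a U = lim (affine_vol_approx \<mu> a U)"

definition vec_mod :: "nat \<Rightarrow> ('p::prime_card padic ^ 'n::finite) \<Rightarrow> int ^ 'n" where
  "vec_mod m x = (\<chi> i. padic_mod m (x $ i))"

definition affine_N :: "nat \<Rightarrow> ('p::prime_card padic ^ 'n::finite) set \<Rightarrow> nat" where
  "affine_N m U = card (vec_mod m ` U)"


section \<open>Projective space\<close>

text \<open>The index type has \<open>n + 1\<close> elements for the projective space of dimension \<open>n\<close>.\<close>

definition proj_rel :: "('p::prime_card padic ^ 'k::finite) \<Rightarrow> 'p padic ^ 'k \<Rightarrow> bool" where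
  "proj_rel x y \<longleftrightarrow> x \<noteq> 0 \<and> y \<noteq> 0 \<and> (\<exists>c. y = c *s x)"

lemma part_equivp_proj_rel: "part_equivp (proj_rel :: ('p::prime_card padic ^ 'k::finite) \<Rightarrow> _)"
proof (rule part_equivpI)
  show "\<exists>x. proj_rel x (x :: 'p padic ^ 'k)"
    by (auto simp: proj_rel_def vec_eq_iff intro!: exI[of _ "\<chi> i. 1"] exI[of _ 1])
  show "symp (proj_rel :: ('p padic ^ 'k) \<Rightarrow> _)"
  proof (rule sympI)
    fix x y :: "'p padic ^ 'k" assume "proj_rel x y"
    then obtain c where c: "x \<noteq> 0" "y \<noteq> 0" "y = c *s x" by (auto simp: proj_rel_def)
    then have "c \<noteq> 0" by auto
    then have "x = inverse c *s y" using c by (simp add: vector_smult_assoc)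
    then show "proj_rel y x" using c(1,2) unfolding proj_rel_def by blast
  qed
  show "transp (proj_rel :: ('p padic ^ 'k) \<Rightarrow> _)"
    by (rule transpI) (auto simp: proj_rel_def vector_smult_assoc)
qed

quotient_type (overloaded) ('p, 'k) proj_space =
  "'p::prime_card padic ^ 'k::finite" / partial: proj_rel
  by (rule part_equivp_proj_rel)

abbreviation proj :: "('p::prime_card padic ^ 'k::finite) \<Rightarrow> ('p, 'k) proj_space" where
  "proj \<equiv> abs_proj_space"

definition unit_sphere :: "('p::prime_card padic ^ 'k::finite) set" where
  "unit_sphere = {x. max_norm x = 1}"

definition unit_rep :: "('p::prime_card, 'k::finite) proj_space \<Rightarrow> 'p padic ^ 'k" where
  "unit_rep x = (SOME v. v \<in> unit_sphere \<and> proj v = x)"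

lemma max_norm_le_iff: "max_norm x \<le> c \<longleftrightarrow> (\<forall>i. padic_norm (x $ i) \<le> c)"
  by (auto simp: max_norm_def)

lemma norm_le_max_norm: "padic_norm (x $ i) \<le> max_norm x"
  by (auto simp: max_norm_def)

lemma max_norm_attained: "\<exists>i. max_norm x = padic_norm (x $ i)"
proof -
  have "max_norm x \<in> range (\<lambda>i. padic_norm (x $ i))" unfolding max_norm_def by (intro Max_in) auto
  then show ?thesis by auto
qed

lemma max_norm_mult: "max_norm (c *s x) = padic_norm c * max_norm x"
proof (rule antisym)
  show "max_norm (c *s x) \<le> padic_norm c * max_norm x"
    by (auto simp: max_norm_le_iff padic_norm_mult padic_norm_nonneg norm_le_max_norm intro: mult_left_mono)
  obtain i where "max_norm x = padic_norm (x $ i)" using max_norm_attained by blast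
  then show "padic_norm c * max_norm x \<le> max_norm (c *s x)"
    using norm_le_max_norm[of "c *s x" i] by (simp add: padic_norm_mult)
qed

lemma unit_sphere_nonzero: "x \<in> unit_sphere \<Longrightarrow> x \<noteq> 0"
  by (auto simp: unit_sphere_def max_norm_def)

lemma proj_eq_iff: "x \<noteq> 0 \<Longrightarrow> y \<noteq> 0 \<Longrightarrow> proj x = proj y \<longleftrightarrow> (\<exists>c. y = c *s x)"
  using Quotient_rel[OF Quotient_proj_space, of x y]
  by (auto simp: proj_rel_def intro: exI[of _ 1])

lemma unit_rep: "unit_rep x \<in> unit_sphere" "proj (unit_rep x) = x"
proof -
  define v where "v = rep_proj_space x"
  have "proj_rel v v" unfolding v_def by (rule Quotient_rep_reflp[OF Quotient_proj_space])
  then have v: "v \<noteq> 0" by (simp add: proj_rel_def)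
  obtain i where i: "max_norm v = padic_norm (v $ i)" using max_norm_attained by blast
  obtain j where "v $ j \<noteq> 0" using v by (auto simp: vec_eq_iff)
  then have "padic_norm (v $ j) > 0"
    using padic_norm_eq_0_iff[of "v $ j"] padic_norm_nonneg[of "v $ j"] by linarith
  then have "padic_norm (v $ i) > 0" using norm_le_max_norm[of v j] i by linarith
  define u where "u = inverse (v $ i) *s v"
  have u: "u \<in> unit_sphere"
    using i \<open>padic_norm (v $ i) > 0\<close>
    by (simp add: u_def unit_sphere_def max_norm_mult padic_norm_inverse)
  have "proj u = proj v"
    using proj_eq_iff[OF v unit_sphere_nonzero[OF u]] by (auto simp: u_def)
  also have "\<dots> = x" unfolding v_def by (rule Quotient_abs_rep[OF Quotient_proj_space])
  finally have "\<exists>v. v \<in> unit_sphere \<and> proj v = x" using u by blast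
  from someI_ex[OF this] show "unit_rep x \<in> unit_sphere" "proj (unit_rep x) = x"
    by (simp_all add: unit_rep_def)
qed

lemma unit_rep_proj:
  assumes "x \<in> unit_sphere"
  obtains c where "padic_norm c = 1" "unit_rep (proj x) = c *s x"
proof -
  let ?y = "unit_rep (proj x)"
  have y: "?y \<in> unit_sphere" "proj ?y = proj x" by (rule unit_rep)+
  then obtain c where c: "?y = c *s x"
    using proj_eq_iff[OF unit_sphere_nonzero[OF assms] unit_sphere_nonzero[OF y(1)]] by auto
  then have "padic_norm c = 1" using assms y(1) by (simp add: unit_sphere_def max_norm_mult)
  then show ?thesis using that c by blast
qed

subsection \<open>The metric\<close>

definition wedge_norm :: "('p::prime_card padic ^ 'k::finite) \<Rightarrow> 'p padic ^ 'k \<Rightarrow> real" where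
  "wedge_norm x y = Max (range (\<lambda>(i, j). padic_norm (x $ i * y $ j - x $ j * y $ i)))"

lemma wedge_norm_le_iff:
  "wedge_norm x y \<le> c \<longleftrightarrow> (\<forall>i j. padic_norm (x $ i * y $ j - x $ j * y $ i) \<le> c)"
  by (auto simp: wedge_norm_def)

lemma minor_le_wedge_norm: "padic_norm (x $ i * y $ j - x $ j * y $ i) \<le> wedge_norm x y"
  using wedge_norm_le_iff by blast

lemma wedge_norm_commute: "wedge_norm x y = wedge_norm y x"
proof -
  have "wedge_norm x y \<le> wedge_norm y x" for x y :: "'p::prime_card padic ^ 'k::finite"
    unfolding wedge_norm_le_iff
    using minor_le_wedge_norm[of y] padic_norm_diff_commute by (metis mult.commute)
  then show ?thesis by (metis antisym)
qed

lemma wedge_norm_scale: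
  assumes c: "padic_norm c = 1"
  shows "wedge_norm (c *s x) y = wedge_norm x y"
proof -
  have "padic_norm (c * x $ i * y $ j - c * x $ j * y $ i) = padic_norm (x $ i * y $ j - x $ j * y $ i)" for i j
  proof -
    have "c * x $ i * y $ j - c * x $ j * y $ i = c * (x $ i * y $ j - x $ j * y $ i)"
      by (simp add: algebra_simps)
    then show ?thesis by (simp only: padic_norm_mult c mult_1)
  qed
  then show ?thesis by (simp add: wedge_norm_def)
qed

lemma wedge_norm_ultrametric:
  fixes u v w :: "'p::prime_card padic ^ 'k::finite"
  assumes u: "u \<in> unit_sphere" and v: "v \<in> unit_sphere" and w: "w \<in> unit_sphere"
  shows "wedge_norm u w \<le> max (wedge_norm u v) (wedge_norm w v)"
  unfolding wedge_norm_le_iff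
proof (intro allI)
  fix j k
  define M where "M = max (wedge_norm u v) (wedge_norm w v)"
  have le1: "padic_norm (u $ l) \<le> 1" "padic_norm (v $ l) \<le> 1" "padic_norm (w $ l) \<le> 1" for l
    using u v w norm_le_max_norm[of u l] norm_le_max_norm[of v l] norm_le_max_norm[of w l]
    by (simp_all add: unit_sphere_def)
  obtain i where i: "padic_norm (v $ i) = 1"
    using max_norm_attained[of v] v by (auto simp: unit_sphere_def)
  define a where "a l = u $ l * v $ i - u $ i * v $ l" for l
  define b where "b l = w $ l * v $ i - w $ i * v $ l" for l
  have a: "padic_norm (a l) \<le> M" and b: "padic_norm (b l) \<le> M" for l
    using minor_le_wedge_norm[of u l v i] minor_le_wedge_norm[of w l v i]
    by (auto simp: a_def b_def M_def)
  have a1: "padic_norm (a l) \<le> 1" for l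
    unfolding a_def by (intro padic_norm_diff_le padic_norm_mult_le le1)
  have "v $ i * v $ i * (u $ j * w $ k - u $ k * w $ j) =
      u $ i * (v $ j * b k - v $ k * b j) + w $ i * (v $ k * a j - v $ j * a k)
      + (a j * b k - a k * b j)"
    by (simp add: a_def b_def algebra_simps)
  moreover have "padic_norm (u $ i * (v $ j * b k - v $ k * b j) + w $ i * (v $ k * a j - v $ j * a k)
      + (a j * b k - a k * b j)) \<le> M"
    by (intro padic_norm_add_le padic_norm_diff_le padic_norm_mult_le le1 a1 a b)
  ultimately have "padic_norm (v $ i * v $ i * (u $ j * w $ k - u $ k * w $ j)) \<le> M" by simp
  then show "padic_norm (u $ j * w $ k - u $ k * w $ j) \<le> max (wedge_norm u v) (wedge_norm w v)"
    by (simp add: padic_norm_mult i M_def)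
qed

lemma wedge_norm_eq_0_iff:
  assumes x: "x \<in> unit_sphere" and y: "y \<in> unit_sphere"
  shows "wedge_norm x y = 0 \<longleftrightarrow> proj x = proj y"
proof
  assume 0: "wedge_norm x y = 0"
  obtain i where i: "padic_norm (x $ i) = 1"
    using max_norm_attained[of x] x by (auto simp: unit_sphere_def)
  then have nz: "x $ i \<noteq> 0" by auto
  have "x $ i * y $ j = x $ j * y $ i" for j
  proof -
    have "padic_norm (x $ i * y $ j - x $ j * y $ i) = 0"
      using minor_le_wedge_norm[of x i y j] 0 padic_norm_nonneg[of "x $ i * y $ j - x $ j * y $ i"] by linarith
    then show ?thesis by (simp add: padic_norm_eq_0_iff)
  qed
  then have "y = (y $ i / x $ i) *s x"
    using nz by (simp add: vec_eq_iff field_simps)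
  then show "proj x = proj y"
    using proj_eq_iff[OF unit_sphere_nonzero[OF x] unit_sphere_nonzero[OF y]] by blast
next
  assume "proj x = proj y"
  then obtain c where "y = c *s x"
    using proj_eq_iff[OF unit_sphere_nonzero[OF x] unit_sphere_nonzero[OF y]] by blast
  then have "wedge_norm x y \<le> 0" by (simp add: wedge_norm_le_iff)
  moreover have "0 \<le> wedge_norm x y"
    using minor_le_wedge_norm[of x _ y] padic_norm_nonneg order_trans by blast
  ultimately show "wedge_norm x y = 0" by simp
qed

instantiation proj_space :: (prime_card, finite) metric_space
begin

definition dist_proj_space :: "('a, 'b) proj_space \<Rightarrow> ('a, 'b) proj_space \<Rightarrow> real" where
  "dist_proj_space x y = wedge_norm (unit_rep x) (unit_rep y)"

definition uniformity_proj_space :: "(('a, 'b) proj_space \<times> ('a, 'b) proj_space) filter" where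
  "uniformity_proj_space = (INF e\<in>{0<..}. principal {(x, y). dist x y < e})"

definition open_proj_space :: "('a, 'b) proj_space set \<Rightarrow> bool" where
  "open_proj_space U = (\<forall>x\<in>U. eventually (\<lambda>(x', y). x' = x \<longrightarrow> y \<in> U) uniformity)"

instance
proof
  fix x y z :: "('a, 'b) proj_space" and U :: "('a, 'b) proj_space set"
  show "uniformity = (INF e\<in>{0 <..}. principal {(x :: ('a, 'b) proj_space, y). dist x y < e})"
    by (rule uniformity_proj_space_def)
  show "open U = (\<forall>x\<in>U. \<forall>\<^sub>F (x', y) in uniformity. x' = x \<longrightarrow> y \<in> U)"
    by (rule open_proj_space_def)
  show eq0: "dist x y = 0 \<longleftrightarrow> x = y" for x y :: "('a, 'b) proj_space"
    using wedge_norm_eq_0_iff[OF unit_rep(1)[of x] unit_rep(1)[of y]]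
    by (simp add: dist_proj_space_def unit_rep(2))
  have nonneg: "0 \<le> wedge_norm u v" for u v :: "'a padic ^ 'b"
    using minor_le_wedge_norm[of u _ v] padic_norm_nonneg order_trans by blast
  show "dist x y \<le> dist x z + dist y z"
    using wedge_norm_ultrametric[OF unit_rep(1)[of x] unit_rep(1)[of z] unit_rep(1)[of y]]
      nonneg[of "unit_rep x" "unit_rep z"] nonneg[of "unit_rep y" "unit_rep z"]
    by (simp add: dist_proj_space_def)
qed

end

lemma dist_proj:
  assumes x: "x \<in> unit_sphere" and y: "y \<in> unit_sphere"
  shows "dist (proj x) (proj y) = wedge_norm x y"
proof -
  obtain c where c: "padic_norm c = 1" "unit_rep (proj x) = c *s x" using unit_rep_proj[OF x] .
  obtain d where d: "padic_norm d = 1" "unit_rep (proj y) = d *s y" using unit_rep_proj[OF y] .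
  show ?thesis
    unfolding dist_proj_space_def c(2) d(2) wedge_norm_scale[OF c(1)]
    by (metis wedge_norm_commute wedge_norm_scale[OF d(1)])
qed

subsection \<open>Algebraic sets, volume and number of residues\<close>

definition proj_algebraic :: "('p::prime_card, 'k::finite) proj_space set \<Rightarrow> bool" where
  "proj_algebraic A \<longleftrightarrow>
     (\<exists>F :: (('k \<Rightarrow>\<^sub>0 nat) \<Rightarrow>\<^sub>0 'p padic) set. (\<forall>f\<in>F. homogeneous_poly f) \<and>
        A = proj ` {x. x \<noteq> 0 \<and> (\<forall>f\<in>F. poly_eval f x = 0)})"

definition proj_measure ::
    "('p::prime_card padic ^ 'k::finite) measure \<Rightarrow> ('p, 'k) proj_space set \<Rightarrow> real" where
  "proj_measure \<mu> W = 1 / (1 - 1 / real CARD('p)) * measure \<mu> {x \<in> unit_sphere. proj x \<in> W}"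

definition proj_vol_approx ::
    "('p::prime_card padic ^ 'k::finite) measure \<Rightarrow> nat \<Rightarrow> ('p, 'k) proj_space set \<Rightarrow> nat \<Rightarrow> real" where
  "proj_vol_approx \<mu> a U m =
     real CARD('p) powi (int m * (int CARD('k) - 1 - int a)) *
     proj_measure \<mu> (\<Union>x\<in>U. cball x (1 / real CARD('p) ^ m))"

definition proj_vol ::
    "('p::prime_card padic ^ 'k::finite) measure \<Rightarrow> nat \<Rightarrow> ('p, 'k) proj_space set \<Rightarrow> real" where
  "proj_vol \<mu> a U = lim (proj_vol_approx \<mu> a U)"

text \<open>A point of the projective space over the local ring \<open>\<int>/p\<^sup>m\<int>\<close> is the orbit, under the
  units of the ring, of a vector that is not divisible by \<open>p\<close>.\<close>

definition unit_orbit :: "nat \<Rightarrow> nat \<Rightarrow> int ^ 'k::finite \<Rightarrow> (int ^ 'k) set" where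
  "unit_orbit p m v = {\<chi> i. (c * v $ i) mod int p ^ m | c. coprime c (int p ^ m)}"

definition proj_mod :: "nat \<Rightarrow> ('p::prime_card, 'k::finite) proj_space \<Rightarrow> (int ^ 'k) set" where
  "proj_mod m x = unit_orbit CARD('p) m (vec_mod m (unit_rep x))"

lemma proj_mod_proj:
  assumes x: "(x :: 'p::prime_card padic ^ 'k::finite) \<in> unit_sphere"
  shows "proj_mod m (proj x) = unit_orbit CARD('p) m (vec_mod m x)"
proof -
  let ?q = "int CARD('p) ^ m"
  have sub: "unit_orbit CARD('p) m (vec_mod m (d *s y)) \<subseteq> unit_orbit CARD('p) m (vec_mod m y)"
    if d: "padic_norm d = 1" and y: "y \<in> unit_sphere" for d and y :: "'p padic ^ 'k"
  proof -
    have y1: "padic_norm (y $ i) \<le> 1" for i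
      using y norm_le_max_norm[of y i] by (simp add: unit_sphere_def)
    have "padic_mod m (d * inverse d) = (padic_mod m d * padic_mod m (inverse d)) mod ?q"
      using d by (intro padic_mod_mult) (auto simp: padic_norm_inverse)
    moreover have "d * inverse d = 1" using d by (intro right_inverse) auto
    ultimately have "(padic_mod m d * padic_mod m (inverse d)) mod ?q = 1 mod ?q"
      by (simp add: padic_mod_1)
    then have "[padic_mod m d * padic_mod m (inverse d) = 1] (mod ?q)" by (simp add: cong_def)
    then have cop: "coprime (padic_mod m d) ?q" by (metis coprime_iff_invertible_int)
    show ?thesis
    proof
      fix w assume "w \<in> unit_orbit CARD('p) m (vec_mod m (d *s y))"
      then obtain c where c: "coprime c ?q" "w = (\<chi> i. (c * vec_mod m (d *s y) $ i) mod ?q)"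
        by (auto simp: unit_orbit_def)
      have "w = (\<chi> i. ((c * padic_mod m d) * vec_mod m y $ i) mod ?q)"
        unfolding c(2) using d y1
        by (simp add: vec_eq_iff vec_mod_def padic_mod_mult mod_mult_right_eq mult.assoc)
      moreover have "coprime (c * padic_mod m d) ?q" using c(1) cop by auto
      ultimately show "w \<in> unit_orbit CARD('p) m (vec_mod m y)"
        unfolding unit_orbit_def by blast
    qed
  qed
  obtain c where c: "padic_norm c = 1" "unit_rep (proj x) = c *s x" using unit_rep_proj[OF x] .
  have "c \<noteq> 0" using c(1) by auto
  then have "x = inverse c *s (c *s x)" by (simp add: vector_smult_assoc)
  moreover have "c *s x \<in> unit_sphere" using c x by (simp add: unit_sphere_def max_norm_mult)
  ultimately show ?thesis
    unfolding proj_mod_def c(2)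
    using sub[OF c(1) x] sub[of "inverse c" "c *s x"] c(1)
    by (auto simp: padic_norm_inverse)
qed

definition proj_N :: "nat \<Rightarrow> ('p::prime_card, 'k::finite) proj_space set \<Rightarrow> nat" where
  "proj_N m U = card (proj_mod m ` U)"

end

theory Submission
  imports Defs "HOL-Number_Theory.Totient"
begin

text \<open>
  Write \<open>q = p\<^sup>m\<close>. The two sequences whose limits are compared agree term by term, for all \<open>m\<close> in the
  affine case and for \<open>m \<ge> 1\<close> in the projective case.

  The ball of radius \<open>1/q\<close> around an integral vector is exactly a fibre of reduction modulo \<open>q\<close>. All
  \<open>q\<^sup>n\<close> fibres are translates of one another and they partition \<open>\<int>\<^sub>p\<^sup>n\<close>, so each has measure \<open>q\<^sup>-\<^sup>n\<close>;
  hence the preimage of any set \<open>T\<close> of residue vectors has measure \<open>card T / q\<^sup>n\<close>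
  (\<open>measure_residue_preimage\<close>). The neighbourhood of \<open>U\<close> of radius \<open>1/q\<close> is the preimage of the
  reduction of \<open>U\<close>, and therefore has measure \<open>N\<^sub>m(U) / q\<^sup>n\<close>, which is the affine case.

  In the projective case the preimage in the unit sphere of the ball around \<open>x\<close> consists of the
  integral vectors whose reduction lies in the orbit of a primitive vector representing \<open>x\<close> under the
  units of \<open>\<int>/q\<int>\<close> (\<open>vec_mod_in_proj_mod_iff\<close>). The units act freely on primitive residue vectors, so
  every orbit has \<open>totient q = q (1 - 1/p)\<close> elements, and distinct orbits are disjoint. So the cone
  over the neighbourhood of \<open>U\<close> has measure \<open>N\<^sub>m(U) q (1 - 1/p) / q\<^sup>k\<close>; the normalization of the
  projective measure cancels the factor \<open>1 - 1/p\<close>, and what remains is \<open>N\<^sub>m(U) / q\<^sup>k\<^sup>-\<^sup>1\<close>.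
\<close>

section \<open>Reduction modulo a prime power\<close>

lemma CARD_prime_gt_1: "real CARD('p::prime_card) > 1"
  by (rule p_gt_1[OF prime_CARD])

lemma padic_norm_of_int_le_1: "padic_norm (of_int k :: 'p::prime_card padic) \<le> 1"
  using padic_norm_of_int_le_iff[where 'p='p, of k 0] by simp

lemma padic_mod_eq_mod_iff:
  assumes x: "padic_norm (x :: 'p::prime_card padic) \<le> 1"
  shows "padic_mod m x = k mod int CARD('p) ^ m \<longleftrightarrow>
    padic_norm (x - of_int k) \<le> 1 / real CARD('p) ^ m"
proof
  assume "padic_mod m x = k mod int CARD('p) ^ m"
  then have "int CARD('p) ^ m dvd padic_mod m x - k"
    by (metis mod_eq_dvd_iff mod_mod_trivial)
  then have "padic_norm (of_int (padic_mod m x - k) :: 'p padic) \<le> 1 / real CARD('p) ^ m"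
    by (simp only: padic_norm_of_int_le_iff)
  from padic_norm_add_le[OF padic_mod(2)[OF x] this]
  show "padic_norm (x - of_int k) \<le> 1 / real CARD('p) ^ m" by simp
qed (rule padic_mod_eqI)

lemma padic_mod_eq_iff:
  assumes x: "padic_norm (x :: 'p::prime_card padic) \<le> 1" and y: "padic_norm y \<le> 1"
  shows "padic_mod m x = padic_mod m y \<longleftrightarrow> padic_norm (x - y) \<le> 1 / real CARD('p) ^ m"
proof -
  let ?k = "padic_mod m y"
  have k: "padic_norm (y - of_int ?k) \<le> 1 / real CARD('p) ^ m" by (rule padic_mod(2)[OF y])
  have "?k mod int CARD('p) ^ m = ?k" using padic_mod(1)[OF y, of m] by simp
  then have "padic_mod m x = ?k \<longleftrightarrow> padic_norm (x - of_int ?k) \<le> 1 / real CARD('p) ^ m"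
    using padic_mod_eq_mod_iff[OF x, of m ?k] by simp
  also have "\<dots> \<longleftrightarrow> padic_norm (x - y) \<le> 1 / real CARD('p) ^ m"
    using padic_norm_diff_le[OF _ k, of "x - of_int ?k"] padic_norm_add_le[OF _ k, of "x - y"]
    by auto
  finally show ?thesis .
qed

lemma vec_mod_eq_iff:
  assumes x: "(x :: 'p::prime_card padic ^ 'n::finite) \<in> Zp_vectors" and y: "y \<in> Zp_vectors"
  shows "vec_mod m x = vec_mod m y \<longleftrightarrow> max_norm (x - y) \<le> 1 / real CARD('p) ^ m"
  using assms by (simp add: vec_eq_iff vec_mod_def max_norm_le_iff Zp_vectors_def padic_mod_eq_iff)

definition residue_vectors :: "nat \<Rightarrow> nat \<Rightarrow> (int ^ 'n::finite) set" where
  "residue_vectors p m = {t. \<forall>i. t $ i \<in> {0..<int p ^ m}}"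

lemma residue_vectors_eq_image:
  "residue_vectors p m = vec_lambda ` (UNIV \<rightarrow>\<^sub>E {0..<int p ^ m})"
proof
  show "residue_vectors p m \<subseteq> vec_lambda ` (UNIV \<rightarrow>\<^sub>E {0..<int p ^ m})"
  proof
    fix t :: "int ^ 'n" assume "t \<in> residue_vectors p m"
    then have "vec_nth t \<in> UNIV \<rightarrow>\<^sub>E {0..<int p ^ m}" by (auto simp: residue_vectors_def)
    then show "t \<in> vec_lambda ` (UNIV \<rightarrow>\<^sub>E {0..<int p ^ m})" by (metis imageI vec_nth_inverse)
  qed
qed (auto simp: residue_vectors_def PiE_iff)

lemma finite_residue_vectors: "finite (residue_vectors p m :: (int ^ 'n::finite) set)"
  unfolding residue_vectors_eq_image by (intro finite_imageI finite_PiE) auto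

lemma card_residue_vectors: "card (residue_vectors p m :: (int ^ 'n::finite) set) = (p ^ m) ^ CARD('n)"
proof -
  have "inj_on vec_lambda ((UNIV :: 'n set) \<rightarrow>\<^sub>E {0..<int p ^ m})"
    by (auto intro!: inj_onI simp: vec_lambda_inject)
  then have "card (residue_vectors p m :: (int ^ 'n) set) = card ((UNIV :: 'n set) \<rightarrow>\<^sub>E {0..<int p ^ m})"
    unfolding residue_vectors_eq_image by (rule card_image)
  also have "\<dots> = (p ^ m) ^ CARD('n)"
    by (subst card_PiE) (auto simp: nat_power_eq)
  finally show ?thesis .
qed

lemma vec_mod_in_residue_vectors:
  "(x :: 'p::prime_card padic ^ 'n::finite) \<in> Zp_vectors \<Longrightarrow> vec_mod m x \<in> residue_vectors CARD('p) m"
  using padic_mod(1) by (auto simp: vec_mod_def residue_vectors_def Zp_vectors_def)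

section \<open>Haar measure of the fibres of reduction\<close>

definition vec_of_int :: "int ^ 'n::finite \<Rightarrow> 'p::prime_card padic ^ 'n" where
  "vec_of_int t = (\<chi> i. of_int (t $ i))"

lemma fibre_vec_mod_eq_translate:
  assumes t: "t \<in> residue_vectors CARD('p) m"
  shows "{y \<in> Zp_vectors. vec_mod m (y :: 'p::prime_card padic ^ 'n::finite) = t} =
    (\<lambda>x. vec_of_int t + x) ` {x. max_norm x \<le> 1 / real CARD('p) ^ m}" (is "?F = ?T ` ?B")
proof -
  have tm: "t $ i mod int CARD('p) ^ m = t $ i" for i
    using t by (simp add: residue_vectors_def)
  have le1: "1 / real CARD('p) ^ m \<le> 1"
    using CARD_prime_gt_1[where 'p='p] by simp
  have iff: "y \<in> ?F \<longleftrightarrow> y - vec_of_int t \<in> ?B" for y :: "'p padic ^ 'n"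
  proof -
    have Z: "y \<in> Zp_vectors" if B: "y - vec_of_int t \<in> ?B"
      unfolding Zp_vectors_def
    proof (intro CollectI allI)
      fix i
      have "padic_norm (y $ i - of_int (t $ i)) \<le> 1"
        using B le1 order_trans by (fastforce simp: max_norm_le_iff vec_of_int_def)
      from padic_norm_add_le[OF this padic_norm_of_int_le_1[of "t $ i"]]
      show "padic_norm (y $ i) \<le> 1" by simp
    qed
    have "vec_mod m y = t \<longleftrightarrow> y - vec_of_int t \<in> ?B" if "y \<in> Zp_vectors"
      using that padic_mod_eq_mod_iff[of "y $ i" m "t $ i" for i] tm
      by (simp add: vec_eq_iff vec_mod_def max_norm_le_iff vec_of_int_def Zp_vectors_def)
    then show ?thesis using Z by auto
  qed
  show ?thesis
  proof (intro set_eqI iffI)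
    fix y assume "y \<in> ?F"
    then have "?T (y - vec_of_int t) \<in> ?T ` ?B" using iff by (intro imageI) blast
    then show "y \<in> ?T ` ?B" by simp
  qed (auto simp: iff simp del: mem_Collect_eq)
qed

lemma closed_padic_norm_le: "closed {x :: 'p::prime_card padic. padic_norm x \<le> r}"
proof -
  have "{x :: 'p padic. padic_norm x \<le> r} = cball 0 r"
    by (auto simp: dist_padic_def padic_norm_minus)
  then show ?thesis by simp
qed

lemma closed_max_norm_le: "closed {x :: 'p::prime_card padic ^ 'n::finite. max_norm x \<le> r}"
proof -
  have "{x :: 'p padic ^ 'n. max_norm x \<le> r} = (\<Inter>i. (\<lambda>x. x $ i) -` {x. padic_norm x \<le> r})"
    by (auto simp: max_norm_le_iff)
  then show ?thesis
    by (simp only:) (intro closed_INT ballI closed_vimage_vec_nth closed_padic_norm_le)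
qed

text \<open>A translation-invariant measure does not distinguish the residue classes, so the fibres share the
  total mass \<open>1\<close> equally.\<close>

lemma measure_residue_preimage:
  fixes \<mu> :: "('p::prime_card padic ^ 'n::finite) measure"
  assumes haar: "normalized_haar_measure \<mu>" and T: "T \<subseteq> residue_vectors CARD('p) m"
  shows "measure \<mu> {y \<in> Zp_vectors. vec_mod m y \<in> T} =
    real (card T) / real CARD('p) ^ (m * CARD('n))"
proof -
  define R :: "(int ^ 'n) set" where "R = residue_vectors CARD('p) m"
  define B :: "('p padic ^ 'n) set" where "B = {x. max_norm x \<le> 1 / real CARD('p) ^ m}"
  define F :: "int ^ 'n \<Rightarrow> ('p padic ^ 'n) set" where "F t = {y \<in> Zp_vectors. vec_mod m y = t}" for t
  have sets: "sets \<mu> = sets borel" using haar by (simp add: normalized_haar_measure_def)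
  have translate: "emeasure \<mu> ((\<lambda>x. v + x) ` E) = emeasure \<mu> E" if "E \<in> sets borel" for v E
    using haar that by (simp add: normalized_haar_measure_def)
  have F: "F t = (\<lambda>x. vec_of_int t + x) ` B" if "t \<in> R" for t
    unfolding F_def B_def using that fibre_vec_mod_eq_translate[of t] by (simp add: R_def)
  have F_eq: "F t = {y. max_norm (y - vec_of_int t) \<le> 1 / real CARD('p) ^ m}" if "t \<in> R" for t
  proof -
    have "y \<in> (\<lambda>x. vec_of_int t + x) ` B \<longleftrightarrow> y - vec_of_int t \<in> B" for y
      by (auto intro: image_eqI[of _ _ "y - vec_of_int t"])
    then show ?thesis unfolding F[OF that] by (auto simp: B_def)
  qed
  have F_sets: "F t \<in> sets \<mu>" if "t \<in> R" for t
  proof -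
    have "F t = (\<Inter>i. (\<lambda>y. y $ i) -` cball (of_int (t $ i)) (1 / real CARD('p) ^ m))"
      unfolding F_eq[OF that]
      by (auto simp: max_norm_le_iff vec_of_int_def dist_padic_def padic_norm_diff_commute)
    then have "closed (F t)" by (auto intro!: closed_INT closed_vimage_vec_nth)
    then show ?thesis unfolding sets by (rule borel_closed)
  qed
  have F_emeasure: "emeasure \<mu> (F t) = emeasure \<mu> B" if "t \<in> R" for t
    unfolding F[OF that] by (rule translate) (simp add: B_def borel_closed closed_max_norm_le)
  have disj: "disjoint_family_on F S" for S
    by (auto simp: disjoint_family_on_def F_def)
  have union: "emeasure \<mu> {y \<in> Zp_vectors. vec_mod m y \<in> S} = of_nat (card S) * emeasure \<mu> B"
    if S: "S \<subseteq> R" for S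
  proof -
    have fin: "finite S"
      using S finite_residue_vectors unfolding R_def by (rule finite_subset)
    have "{y \<in> Zp_vectors. vec_mod m y \<in> S} = (\<Union>t\<in>S. F t)" by (auto simp: F_def)
    also have "emeasure \<mu> \<dots> = (\<Sum>t\<in>S. emeasure \<mu> (F t))"
      using S F_sets by (intro sum_emeasure[symmetric] disj fin) auto
    also have "\<dots> = of_nat (card S) * emeasure \<mu> B"
      using S F_emeasure by (simp add: subset_iff)
    finally show ?thesis .
  qed
  have cardR: "real (card R) = real CARD('p) ^ (m * CARD('n))"
    unfolding R_def card_residue_vectors by (simp add: power_mult)
  have "{y \<in> Zp_vectors. vec_mod m (y :: 'p padic ^ 'n) \<in> R} = Zp_vectors"
    using vec_mod_in_residue_vectors by (auto simp: R_def)
  then have "of_nat (card R) * emeasure \<mu> B = 1"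
    using union[of R] haar by (simp add: normalized_haar_measure_def)
  from arg_cong[OF this, of enn2real] have "real (card R) * measure \<mu> B = 1"
    by (simp add: measure_def enn2real_mult)
  then have B: "measure \<mu> B = 1 / real CARD('p) ^ (m * CARD('n))"
    unfolding cardR using CARD_prime_gt_1[where 'p='p] by (simp add: field_simps)
  have "measure \<mu> {y \<in> Zp_vectors. vec_mod m y \<in> T} = real (card T) * measure \<mu> B"
    using union[of T] T by (simp add: R_def measure_def enn2real_mult)
  then show ?thesis using B by simp
qed

section \<open>The affine neighbourhoods\<close>

lemma Union_max_cball_eq_residue_preimage:
  fixes U :: "('p::prime_card padic ^ 'n::finite) set"
  assumes U: "U \<subseteq> Zp_vectors"
  shows "(\<Union>x\<in>U. max_cball x (1 / real CARD('p) ^ m)) = {y \<in> Zp_vectors. vec_mod m y \<in> vec_mod m ` U}"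
proof -
  have le1: "1 / real CARD('p) ^ m \<le> 1"
    using CARD_prime_gt_1[where 'p='p] by simp
  have "y \<in> max_cball x (1 / real CARD('p) ^ m) \<longleftrightarrow> y \<in> Zp_vectors \<and> vec_mod m y = vec_mod m x"
    if x: "x \<in> U" for x y
  proof -
    have xZ: "x \<in> Zp_vectors" using x U by blast
    have "y \<in> Zp_vectors" if y: "max_norm (x - y) \<le> 1 / real CARD('p) ^ m"
      unfolding Zp_vectors_def
    proof (intro CollectI allI)
      fix i
      have "padic_norm (x $ i - y $ i) \<le> 1"
        using y le1 norm_le_max_norm[of "x - y" i] by simp
      moreover have "padic_norm (x $ i) \<le> 1" using xZ by (simp add: Zp_vectors_def)
      ultimately have "padic_norm (x $ i - (x $ i - y $ i)) \<le> 1" by (rule padic_norm_diff_le[rotated])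
      then show "padic_norm (y $ i) \<le> 1" by simp
    qed
    then show ?thesis using vec_mod_eq_iff[OF xZ, of y m] by (auto simp: max_cball_def)
  qed
  then show ?thesis by blast
qed

lemma affine_vol_approx_eq:
  fixes \<mu> :: "('p::prime_card padic ^ 'n::finite) measure"
  assumes haar: "normalized_haar_measure \<mu>" and U: "U \<subseteq> Zp_vectors"
  shows "affine_vol_approx \<mu> a U m = real (affine_N m U) / real CARD('p) ^ (m * a)"
proof -
  have p: "real CARD('p) \<noteq> 0" using CARD_prime_gt_1[where 'p='p] by simp
  have "measure \<mu> (\<Union>x\<in>U. max_cball x (1 / real CARD('p) ^ m)) =
      real (affine_N m U) / real CARD('p) ^ (m * CARD('n))"
    unfolding Union_max_cball_eq_residue_preimage[OF U] affine_N_def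
    using U vec_mod_in_residue_vectors by (intro measure_residue_preimage haar) auto
  moreover have "real CARD('p) powi (int m * (int CARD('n) - int a)) =
      real CARD('p) ^ (m * CARD('n)) / real CARD('p) ^ (m * a)"
    using p by (simp add: right_diff_distrib power_int_diff flip: of_nat_mult)
  ultimately show ?thesis using p by (simp add: affine_vol_approx_def)
qed

section \<open>Orbits of residue vectors under units\<close>

lemma unit_orbit_subset_residue_vectors:
  assumes "p > 0" shows "unit_orbit p m v \<subseteq> residue_vectors p m"
  using assms by (auto simp: unit_orbit_def residue_vectors_def)

lemma unit_orbit_subset:
  assumes w: "w \<in> unit_orbit p m v"
  shows "unit_orbit p m w \<subseteq> unit_orbit p m v"
proof
  obtain c where c: "coprime c (int p ^ m)" "w = (\<chi> i. (c * v $ i) mod int p ^ m)"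
    using w by (auto simp: unit_orbit_def)
  fix z assume "z \<in> unit_orbit p m w"
  then obtain d where d: "coprime d (int p ^ m)" "z = (\<chi> i. (d * w $ i) mod int p ^ m)"
    by (auto simp: unit_orbit_def)
  have "coprime (d * c) (int p ^ m)" using c d by (simp only: coprime_mult_left_iff)
  moreover have "z = (\<chi> i. (d * c * v $ i) mod int p ^ m)"
    using c d by (simp add: vec_eq_iff mod_mult_right_eq mult.assoc)
  ultimately show "z \<in> unit_orbit p m v" unfolding unit_orbit_def by blast
qed

lemma unit_orbit_eq:
  assumes w: "w \<in> unit_orbit p m v"
  shows "unit_orbit p m w = unit_orbit p m v"
proof
  show "unit_orbit p m w \<subseteq> unit_orbit p m v" by (rule unit_orbit_subset[OF w])
  obtain c where c: "coprime c (int p ^ m)" "w = (\<chi> i. (c * v $ i) mod int p ^ m)"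
    using w by (auto simp: unit_orbit_def)
  obtain d where d: "[c * d = 1] (mod int p ^ m)" using cong_solve_coprime_int[OF c(1)] by blast
  show "unit_orbit p m v \<subseteq> unit_orbit p m w"
  proof
    fix z assume "z \<in> unit_orbit p m v"
    then obtain e where e: "coprime e (int p ^ m)" "z = (\<chi> i. (e * v $ i) mod int p ^ m)"
      by (auto simp: unit_orbit_def)
    have "coprime d (int p ^ m)"
      using d coprime_iff_invertible_int[of d "int p ^ m"] by (auto simp: mult.commute)
    then have "coprime (e * d) (int p ^ m)" using e by (simp only: coprime_mult_left_iff)
    moreover have "(e * d * w $ i) mod int p ^ m = z $ i" for i
    proof -
      have "[e * d * (c * v $ i) = e * 1 * v $ i] (mod int p ^ m)"
        using cong_mult[OF cong_mult[OF cong_refl[of e] d] cong_refl[of "v $ i"]]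
        by (simp add: ac_simps)
      then show ?thesis unfolding c(2) e(2) by (simp add: cong_def mod_mult_right_eq)
    qed
    then have "z = (\<chi> i. (e * d * w $ i) mod int p ^ m)" by (simp add: vec_eq_iff)
    ultimately show "z \<in> unit_orbit p m w" unfolding unit_orbit_def by blast
  qed
qed

lemma card_coprime_residues:
  assumes q: "q > 1"
  shows "card {c \<in> {0..<int q}. coprime c (int q)} = totient q"
proof -
  have "{c \<in> {0..<int q}. coprime c (int q)} = int ` totatives q"
  proof (intro set_eqI iffI)
    fix c assume c: "c \<in> {c \<in> {0..<int q}. coprime c (int q)}"
    then have "c \<noteq> 0" using q by auto
    then have "nat c \<in> totatives q" "c = int (nat c)"
      using c by (auto simp: in_totatives_iff simp flip: coprime_int_iff)
    then show "c \<in> int ` totatives q" by blast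
  next
    fix c assume "c \<in> int ` totatives q"
    then show "c \<in> {c \<in> {0..<int q}. coprime c (int q)}"
      using q totatives_less by (auto simp: in_totatives_iff)
  qed
  then show ?thesis by (simp add: card_image totient_def)
qed

text \<open>An invertible coordinate determines the scalar, so that the units act freely.\<close>

lemma card_unit_orbit:
  assumes p: "prime p" and m: "m > 0" and v: "coprime (v $ i) (int p ^ m)"
  shows "card (unit_orbit p m v) = p ^ (m - 1) * (p - 1)"
proof -
  let ?q = "int p ^ m"
  define D where "D = {c \<in> {0..<?q}. coprime c ?q}"
  define f where "f c = (\<chi> i. (c * v $ i) mod ?q)" for c
  have q: "p ^ m > 1" using prime_gt_1_nat[OF p] m by (rule one_less_power)
  have "unit_orbit p m v = f ` D"
  proof (intro set_eqI iffI)
    fix w assume "w \<in> unit_orbit p m v"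
    then obtain c where c: "coprime c ?q" "w = f c" by (auto simp: unit_orbit_def f_def)
    have "?q > 0" using prime_gt_0_nat[OF p] by simp
    moreover from this have "coprime (c mod ?q) ?q"
      using c(1) coprime_mod_left_iff[of ?q c] by linarith
    ultimately have "c mod ?q \<in> D" by (simp add: D_def del: coprime_power_right_iff)
    moreover have "w = f (c mod ?q)" unfolding c(2) by (simp add: f_def mod_mult_left_eq)
    ultimately show "w \<in> f ` D" by blast
  next
    fix w assume "w \<in> f ` D"
    then show "w \<in> unit_orbit p m v" by (auto simp: unit_orbit_def f_def D_def)
  qed
  moreover have "inj_on f D"
  proof (rule inj_onI)
    fix c d assume c: "c \<in> D" and d: "d \<in> D" and "f c = f d"
    then have "[c * v $ i = d * v $ i] (mod ?q)" by (simp add: f_def cong_def vec_eq_iff)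
    then have "[c = d] (mod ?q)" using v cong_mult_rcancel by blast
    then show "c = d" using c d by (simp add: D_def cong_def)
  qed
  ultimately have "card (unit_orbit p m v) = card D" by (simp add: card_image)
  also have "\<dots> = totient (p ^ m)"
    using card_coprime_residues[OF q] by (simp add: D_def)
  also have "\<dots> = p ^ (m - 1) * (p - 1)" using p m by (rule totient_prime_power)
  finally show ?thesis .
qed

section \<open>The projective neighbourhoods\<close>

lemma unit_sphere_subset_Zp_vectors: "unit_sphere \<subseteq> Zp_vectors"
  by (auto simp: unit_sphere_def Zp_vectors_def simp flip: max_norm_le_iff)

lemma unit_sphere_unit_coord:
  assumes "x \<in> unit_sphere"
  obtains i where "padic_norm (x $ i) = 1"
  using max_norm_attained[of x] assms by (auto simp: unit_sphere_def)

lemma coprime_padic_mod: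
  assumes c: "padic_norm (c :: 'p::prime_card padic) = 1"
  shows "coprime (padic_mod m c) (int CARD('p) ^ m)"
proof -
  have "padic_mod m (c * inverse c) = (padic_mod m c * padic_mod m (inverse c)) mod int CARD('p) ^ m"
    using c by (intro padic_mod_mult) (auto simp: padic_norm_inverse)
  moreover have "c * inverse c = 1" using c by (intro right_inverse) auto
  ultimately have "[padic_mod m c * padic_mod m (inverse c) = 1] (mod int CARD('p) ^ m)"
    by (simp add: padic_mod_1 cong_def)
  then show ?thesis by (metis coprime_iff_invertible_int)
qed

text \<open>In an ultrametric triangle the two longest sides are equal.\<close>

lemma padic_norm_add_eq:
  assumes "padic_norm y < padic_norm (x :: 'p::prime_card padic)"
  shows "padic_norm (x + y) = padic_norm x"
  using padic_norm_add[of x y] padic_norm_add[of "x + y" "- y"] padic_norm_minus[of y] assms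
  by auto

lemma padic_norm_of_int_coprime:
  assumes m: "m > 0" and c: "coprime c (int CARD('p::prime_card) ^ m)"
  shows "padic_norm (of_int c :: 'p padic) = 1"
proof -
  obtain d where "[c * d = 1] (mod int CARD('p) ^ m)" using cong_solve_coprime_int[OF c] by blast
  then have "int CARD('p) ^ m dvd c * d - 1" by (simp add: cong_iff_dvd_diff)
  then have "padic_norm (of_int (c * d - 1) :: 'p padic) \<le> 1 / real CARD('p) ^ m"
    by (simp only: padic_norm_of_int_le_iff)
  also have "\<dots> < 1" using CARD_prime_gt_1[where 'p='p] m by simp
  finally have "padic_norm (1 + of_int (c * d - 1) :: 'p padic) = 1"
    using padic_norm_add_eq[of "of_int (c * d - 1)" "1 :: 'p padic"] by simp
  then have "padic_norm (of_int c :: 'p padic) * padic_norm (of_int d :: 'p padic) = 1"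
    by (simp flip: padic_norm_mult)
  moreover have "padic_norm (of_int c :: 'p padic) * padic_norm (of_int d :: 'p padic)
      \<le> padic_norm (of_int c :: 'p padic) * 1"
    by (intro mult_left_mono padic_norm_of_int_le_1 padic_norm_nonneg)
  ultimately show ?thesis using padic_norm_of_int_le_1[where 'p='p, of c] by simp
qed

text \<open>A vector \<open>y\<close> of the unit sphere is projectively close to \<open>u\<close> if and only if it is close to a
  multiple of \<open>u\<close> by a unit: where \<open>u\<close> has an invertible coordinate \<open>i\<close>, the scalar is \<open>y\<^sub>i / u\<^sub>i\<close>, and
  the minors containing \<open>i\<close> bound the difference. The equivalence fails for \<open>m = 0\<close>, where
  \<open>0\<close> is the only residue vector and reduction does not detect whether \<open>y\<close> lies on the sphere.\<close>

lemma vec_mod_in_unit_orbit_iff: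
  fixes u :: "'p::prime_card padic ^ 'k::finite"
  assumes m: "m > 0" and u: "u \<in> unit_sphere" and y: "y \<in> Zp_vectors"
  shows "vec_mod m y \<in> unit_orbit CARD('p) m (vec_mod m u) \<longleftrightarrow>
    y \<in> unit_sphere \<and> wedge_norm u y \<le> 1 / real CARD('p) ^ m"
proof -
  let ?e = "1 / real CARD('p) ^ m"
  have e: "?e < 1" using CARD_prime_gt_1[where 'p='p] m by simp
  have u1: "padic_norm (u $ j) \<le> 1" and y1: "padic_norm (y $ j) \<le> 1" for j
    using u y unit_sphere_subset_Zp_vectors by (auto simp: Zp_vectors_def)
  obtain i where i: "padic_norm (u $ i) = 1" using unit_sphere_unit_coord[OF u] .
  then have ui: "u $ i \<noteq> 0" by auto
  show ?thesis
  proof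
    assume "vec_mod m y \<in> unit_orbit CARD('p) m (vec_mod m u)"
    then obtain c where c: "coprime c (int CARD('p) ^ m)"
      and yc: "vec_mod m y = (\<chi> j. (c * vec_mod m u $ j) mod int CARD('p) ^ m)"
      by (auto simp: unit_orbit_def)
    let ?c = "of_int c :: 'p padic"
    have c1: "padic_norm ?c = 1" by (rule padic_norm_of_int_coprime[OF m c])
    have close: "padic_norm (y $ j - ?c * u $ j) \<le> ?e" for j
    proof -
      have "padic_mod m (y $ j) = (c * padic_mod m (u $ j)) mod int CARD('p) ^ m"
        using yc by (simp add: vec_eq_iff vec_mod_def)
      then have "padic_norm (y $ j - of_int (c * padic_mod m (u $ j))) \<le> ?e"
        using padic_mod_eq_mod_iff[OF y1] by blast
      moreover have "padic_norm (?c * (u $ j - of_int (padic_mod m (u $ j)))) \<le> ?e"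
        using c1 by (intro padic_norm_mult_le padic_mod(2) u1) simp
      ultimately have "padic_norm ((y $ j - of_int (c * padic_mod m (u $ j)))
          - ?c * (u $ j - of_int (padic_mod m (u $ j)))) \<le> ?e"
        by (rule padic_norm_diff_le)
      then show ?thesis by (simp add: algebra_simps)
    qed
    have "padic_norm (?c * u $ i + (y $ i - ?c * u $ i)) = padic_norm (?c * u $ i)"
      using close[of i] e i c1 by (intro padic_norm_add_eq) (simp add: padic_norm_mult)
    then have "padic_norm (y $ i) = 1" using c1 i by (simp add: padic_norm_mult)
    then have "max_norm y = 1"
      using norm_le_max_norm[of y i] y1 by (metis antisym max_norm_le_iff)
    moreover have "padic_norm (u $ j * y $ l - u $ l * y $ j) \<le> ?e" for j l
    proof -
      have "u $ j * y $ l - u $ l * y $ j =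
          u $ j * (y $ l - ?c * u $ l) - u $ l * (y $ j - ?c * u $ j)"
        by (simp add: algebra_simps)
      also have "padic_norm \<dots> \<le> ?e"
        by (intro padic_norm_diff_le padic_norm_mult_le u1 close)
      finally show ?thesis .
    qed
    ultimately show "y \<in> unit_sphere \<and> wedge_norm u y \<le> ?e"
      by (simp add: unit_sphere_def wedge_norm_le_iff)
  next
    assume *: "y \<in> unit_sphere \<and> wedge_norm u y \<le> ?e"
    define c where "c = y $ i / u $ i"
    have close: "padic_norm (y $ j - c * u $ j) \<le> ?e" for j
    proof -
      have "u $ i * (y $ j - c * u $ j) = u $ i * y $ j - u $ j * y $ i"
        using ui by (simp add: c_def field_simps)
      moreover have "padic_norm (u $ i * y $ j - u $ j * y $ i) \<le> ?e"
        using * by (simp add: wedge_norm_le_iff)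
      ultimately have "padic_norm (u $ i * (y $ j - c * u $ j)) \<le> ?e" by simp
      then show ?thesis using i by (simp only: padic_norm_mult mult_1)
    qed
    have "padic_norm c = padic_norm (y $ i)"
      using i by (simp add: c_def divide_inverse padic_norm_mult padic_norm_inverse)
    then have c_le: "padic_norm c \<le> 1" using y1 by simp
    obtain j where j: "padic_norm (y $ j) = 1" using unit_sphere_unit_coord * by blast
    have "padic_norm (y $ j - (y $ j - c * u $ j)) = 1"
      using padic_norm_add_eq[of "- (y $ j - c * u $ j)" "y $ j"] close[of j] e j
      by (simp only: padic_norm_minus) simp
    then have "padic_norm c * padic_norm (u $ j) = 1" by (simp add: padic_norm_mult)
    moreover have "padic_norm c * padic_norm (u $ j) \<le> padic_norm c * 1"
      by (intro mult_left_mono u1 padic_norm_nonneg)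
    ultimately have c1: "padic_norm c = 1" using c_le by simp
    have "padic_mod m (y $ l) = (padic_mod m c * padic_mod m (u $ l)) mod int CARD('p) ^ m" for l
    proof -
      have "padic_mod m (y $ l) = padic_mod m (c * u $ l)"
        using close[of l] c_le by (subst padic_mod_eq_iff) (auto intro: y1 padic_norm_mult_le u1)
      then show ?thesis using padic_mod_mult[OF c_le u1] by simp
    qed
    then have "vec_mod m y = (\<chi> l. (padic_mod m c * vec_mod m u $ l) mod int CARD('p) ^ m)"
      by (simp add: vec_eq_iff vec_mod_def)
    then show "vec_mod m y \<in> unit_orbit CARD('p) m (vec_mod m u)"
      unfolding unit_orbit_def using coprime_padic_mod[OF c1] by blast
  qed
qed

lemma vec_mod_in_proj_mod_iff:
  fixes x :: "('p::prime_card, 'k::finite) proj_space"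
  assumes m: "m > 0" and y: "y \<in> Zp_vectors"
  shows "vec_mod m y \<in> proj_mod m x \<longleftrightarrow>
    y \<in> unit_sphere \<and> proj y \<in> cball x (1 / real CARD('p) ^ m)"
  using vec_mod_in_unit_orbit_iff[OF m unit_rep(1)[of x] y] dist_proj[OF unit_rep(1)[of x], of y]
  by (auto simp: proj_mod_def unit_rep(2))

lemma card_proj_mod:
  fixes x :: "('p::prime_card, 'k::finite) proj_space"
  assumes m: "m > 0"
  shows "card (proj_mod m x) = CARD('p) ^ (m - 1) * (CARD('p) - 1)"
proof -
  obtain i where "padic_norm (unit_rep x $ i) = 1"
    using unit_sphere_unit_coord[OF unit_rep(1)[of x]] .
  then have "coprime (vec_mod m (unit_rep x) $ i) (int CARD('p) ^ m)"
    by (simp only: vec_mod_def vec_lambda_beta coprime_padic_mod)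
  then show ?thesis unfolding proj_mod_def by (rule card_unit_orbit[OF prime_CARD m])
qed

lemma proj_mod_subset_residue_vectors:
  "proj_mod m (x :: ('p::prime_card, 'k::finite) proj_space) \<subseteq> residue_vectors CARD('p) m"
  unfolding proj_mod_def
  by (rule unit_orbit_subset_residue_vectors[OF prime_gt_0_nat[OF prime_CARD]])

text \<open>Projective residues are orbits, hence the blocks of a partition into sets of equal size.\<close>

lemma card_Union_proj_mod:
  fixes U :: "('p::prime_card, 'k::finite) proj_space set"
  assumes m: "m > 0"
  shows "card (\<Union>(proj_mod m ` U)) = proj_N m U * (CARD('p) ^ (m - 1) * (CARD('p) - 1))"
proof -
  have sub: "\<Union>(proj_mod m ` U) \<subseteq> residue_vectors CARD('p) m"
    using proj_mod_subset_residue_vectors by fast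
  have fin: "finite (\<Union>(proj_mod m ` U))"
    by (rule finite_subset[OF sub finite_residue_vectors])
  have "(CARD('p) ^ (m - 1) * (CARD('p) - 1)) * card (proj_mod m ` U) = card (\<Union>(proj_mod m ` U))"
  proof (rule card_partition)
    show "finite (proj_mod m ` U)" using fin by (rule finite_UnionD)
    show "finite (\<Union>(proj_mod m ` U))" by (rule fin)
    show "card C = CARD('p) ^ (m - 1) * (CARD('p) - 1)" if "C \<in> proj_mod m ` U" for C
      using that card_proj_mod[OF m] by auto
    show "C \<inter> D = {}" if CD: "C \<in> proj_mod m ` U" "D \<in> proj_mod m ` U" "C \<noteq> D" for C D
    proof (rule ccontr)
      assume "C \<inter> D \<noteq> {}"
      then obtain w where w: "w \<in> C" "w \<in> D" by blast
      from CD w have "C = unit_orbit CARD('p) m w" "D = unit_orbit CARD('p) m w"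
        using unit_orbit_eq unfolding proj_mod_def by blast+
      then show False using CD by simp
    qed
  qed
  then show ?thesis by (simp add: proj_N_def mult.commute)
qed

lemma proj_vol_approx_eq:
  fixes \<nu> :: "('p::prime_card padic ^ 'k::finite) measure"
  assumes haar: "normalized_haar_measure \<nu>" and m: "m > 0"
  shows "proj_vol_approx \<nu> a U m = real (proj_N m U) / real CARD('p) ^ (m * a)"
proof -
  let ?p = "real CARD('p)"
  have p: "?p > 1" by (rule CARD_prime_gt_1)
  have "{x \<in> unit_sphere. proj x \<in> (\<Union>x\<in>U. cball x (1 / ?p ^ m))} =
      {y \<in> Zp_vectors. vec_mod m y \<in> \<Union>(proj_mod m ` U)}"
    using vec_mod_in_proj_mod_iff[OF m] unit_sphere_subset_Zp_vectors by blast
  moreover have "measure \<nu> {y \<in> Zp_vectors. vec_mod m y \<in> \<Union>(proj_mod m ` U)} =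
      real (card (\<Union>(proj_mod m ` U))) / ?p ^ (m * CARD('k))"
    using proj_mod_subset_residue_vectors by (intro measure_residue_preimage haar) blast
  moreover have "real (card (\<Union>(proj_mod m ` U))) = real (proj_N m U) * (?p ^ m * (1 - 1 / ?p))"
  proof -
    have "?p ^ (m - 1) * (?p - 1) = ?p ^ m * (1 - 1 / ?p)"
      using m p by (cases m) (simp_all add: field_simps)
    then show ?thesis
      unfolding card_Union_proj_mod[OF m] using p by (simp add: of_nat_diff)
  qed
  ultimately have "proj_measure \<nu> (\<Union>x\<in>U. cball x (1 / ?p ^ m)) =
      real (proj_N m U) * ?p ^ m / ?p ^ (m * CARD('k))"
    unfolding proj_measure_def using p by simp
  moreover have "?p powi (int m * (int CARD('k) - 1 - int a)) =
      ?p ^ (m * CARD('k)) / (?p ^ m * ?p ^ (m * a))"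
    using p by (simp add: right_diff_distrib power_int_diff flip: of_nat_mult)
  ultimately show ?thesis using p by (simp add: proj_vol_approx_def)
qed

section \<open>Equality of the limits\<close>

text \<open>Eventually equal sequences have the same limits, so \<open>lim\<close> agrees on them also when neither
  converges.\<close>

lemma lim_cong_eventually:
  fixes f g :: "nat \<Rightarrow> real"
  assumes "eventually (\<lambda>m. f m = g m) sequentially"
  shows "lim f = lim g \<and> (convergent f \<longrightarrow> g \<longlonglongrightarrow> lim f)"
  using tendsto_cong[OF assms] by (simp add: lim_def convergent_LIMSEQ_iff)

theorem corollary25:
  fixes \<mu> :: "('p::prime_card padic ^ 'n::finite) measure"
    and \<nu> :: "('p padic ^ 'k::finite) measure"
  shows
    "(\<forall>(A :: ('p padic ^ 'n) set) U (a :: nat).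
        normalized_haar_measure \<mu> \<and>
        affine_algebraic A \<and> krull_dim affine_algebraic A = ereal (real a) \<and>
        U \<subseteq> A \<and> openin (top_of_set A) U \<and> compact U \<longrightarrow>
          affine_vol \<mu> a U = lim (\<lambda>m. real (affine_N m U) / real CARD('p) ^ (m * a)) \<and>
          (convergent (affine_vol_approx \<mu> a U) \<longrightarrow>
             (\<lambda>m. real (affine_N m U) / real CARD('p) ^ (m * a)) \<longlonglongrightarrow> affine_vol \<mu> a U)) \<and>
     (\<forall>(A :: ('p, 'k) proj_space set) U (a :: nat).
        normalized_haar_measure \<nu> \<and>
        proj_algebraic A \<and> krull_dim proj_algebraic A = ereal (real a) \<and>
        U \<subseteq> A \<and> openin (top_of_set A) U \<and> compact U \<longrightarrow>
          proj_vol \<nu> a U = lim (\<lambda>m. real (proj_N m U) / real CARD('p) ^ (m * a)) \<and>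
          (convergent (proj_vol_approx \<nu> a U) \<longrightarrow>
             (\<lambda>m. real (proj_N m U) / real CARD('p) ^ (m * a)) \<longlonglongrightarrow> proj_vol \<nu> a U))"
proof (intro conjI[of "\<forall>A. _ A"] allI impI)
  fix A U :: "('p padic ^ 'n) set" and a :: nat
  assume "normalized_haar_measure \<mu> \<and>
    affine_algebraic A \<and> krull_dim affine_algebraic A = ereal (real a) \<and>
    U \<subseteq> A \<and> openin (top_of_set A) U \<and> compact U"
  then have haar: "normalized_haar_measure \<mu>" and "U \<subseteq> Zp_vectors"
    by (auto simp: affine_algebraic_def)
  from affine_vol_approx_eq[OF this]
  show "affine_vol \<mu> a U = lim (\<lambda>m. real (affine_N m U) / real CARD('p) ^ (m * a)) \<and>
    (convergent (affine_vol_approx \<mu> a U) \<longrightarrow>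
      (\<lambda>m. real (affine_N m U) / real CARD('p) ^ (m * a)) \<longlonglongrightarrow> affine_vol \<mu> a U)"
    unfolding affine_vol_def by (intro lim_cong_eventually always_eventually allI)
next
  fix A U :: "('p, 'k) proj_space set" and a :: nat
  assume "normalized_haar_measure \<nu> \<and>
    proj_algebraic A \<and> krull_dim proj_algebraic A = ereal (real a) \<and>
    U \<subseteq> A \<and> openin (top_of_set A) U \<and> compact U"
  then have "normalized_haar_measure \<nu>" by blast
  from proj_vol_approx_eq[OF this]
  show "proj_vol \<nu> a U = lim (\<lambda>m. real (proj_N m U) / real CARD('p) ^ (m * a)) \<and>
    (convergent (proj_vol_approx \<nu> a U) \<longrightarrow>
      (\<lambda>m. real (proj_N m U) / real CARD('p) ^ (m * a)) \<longlonglongrightarrow> proj_vol \<nu> a U)"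
    unfolding proj_vol_def
    by (intro lim_cong_eventually eventually_mono[OF eventually_gt_at_top[of 0]])
qed

end
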